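(* Let $f:\mathbb{R}^n\to\mathbb{R}\cup\{\infty\}$ and $g:\mathbb{R}^m\to\mathbb{R}\cup\{\infty\}$ be proper, convex, closed functions and $A\in\mathbb{R}^{m\times n}$. For step sizes $\tau,\sigma>0$ consider the iteration (Chambolle--Pock method) $(x^k,y^k)\mapsto(x^{k+1},y^{k+1})$ given by $$x^{k+1}=\operatorname{prox}_{\tau f}(x^k-\tau A^\top y^k),\qquad y^{k+1}=\operatorname{prox}_{\sigma g}\big(y^k+\sigma A(2x^{k+1}-x^k)\big).$$ Then the fixed points of this iteration coincide with the solutions of the saddle-point problem $\min_x\max_y f(x)+y^\top Ax-g(y)$. Furthermore, let $\epsilon>0$ and let $\tau,\sigma>0$ satisfy $\tau\sigma\|A\|^2(1+\epsilon)^2\le 1$. Then: (i) If (C1) holds, the iteration is contractive in $\|\cdot\|_{\Phi_{\tau,\sigma}}$ with rate $$\rho=\big(1+\min\{\mu_f\tau,\ \mu_g\sigma,\ \kappa\}\big)^{-1}<1,\qquad \kappa:=\frac{\mu_f\tau+\mu_g\sigma-\sqrt{(\mu_f\tau-\mu_g\sigma)^2+4\|A\|^2\mu_f\mu_g\tau^2\sigma^2}}{2(1-\sigma\tau\|A\|^2)}>0.$$ If $A\neq 0$, among all $\tau,\sigma>0$ with $\tau\sigma\|A\|^2(1+\epsilon)^2\le1$, the best (smallest) rate $\rho$ is obtained with $\tau=\frac{1}{(1+\epsilon)\|A\|}\sqrt{\frac{\mu_g}{\mu_f}}$ and $\sigma=\frac{1}{(1+\epsilon)\|A\|}\sqrt{\frac{\mu_f}{\mu_g}}$.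 (ii) If (C2) holds, the iteration is contractive in $\|\cdot\|_{\Phi_{\tau,\sigma}}$ with rate $$\rho=\frac{R_2\,\zeta_{\tau,\sigma}}{\sqrt{(R_2\,\zeta_{\tau,\sigma})^2+1}}<1.$$ Among all $\tau,\sigma>0$ with $\tau\sigma\|A\|^2(1+\epsilon)^2\le1$, the best rate is obtained with $\tau=\sigma=\frac{1}{(1+\epsilon)\|A\|}$. (iii) If (C3) holds, the iteration is contractive in $\|\cdot\|_{\Phi_{\tau,\sigma}}$ with rate $$\rho=\frac{R_3\,\zeta_{\tau,\sigma}}{\sqrt{(R_3\,\zeta_{\tau,\sigma})^2+1}}<1.$$ Among all $\tau,\sigma>0$ with $\tau\sigma\|A\|^2(1+\epsilon)^2\le1$, the best rate is obtained with $\tau=\sigma=\frac{1}{(1+\epsilon)\|A\|}$.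
   Context: Conditions (on $f,g$ proper convex closed): (C1) $f$ is $\mu_f$-strongly convex and $g$ is $\mu_g$-strongly convex, $\mu_f>0$, $\mu_g>0$. (C2) $g$ is $\mu_g$-strongly convex and $L_g$-smooth (finite, differentiable, with $L_g$-Lipschitz gradient), $\mu_g>0$, $L_g>0$; and $\mu_A:=\lambda_{\min}(A^\top A)>0$. (C3) $f$ is $L_f$-smooth, $g$ is $L_g$-smooth, $L_f,L_g\ge0$; $n=m$ and $\mu_A:=\lambda_{\min}(A^\top A)=\lambda_{\min}(AA^\top)>0$. A solution of the saddle-point problem is a pair $(x^\star,y^\star)\in\operatorname{dom}f\times\operatorname{dom}g$ with $f(x^\star)+y^\top Ax^\star-g(y)\le f(x^\star)+(y^\star)^\top Ax^\star-g(y^\star)\le f(x)+(y^\star)^\top Ax-g(y^\star)$ for all $x\in\operatorname{dom}f$, $y\in\operatorname{dom}g$; equivalently $0\in F(x^\star,y^\star)$, where $F(x,y)=(\partial f(x)+A^\top y,\ \partial g(y)-Ax)$ is the saddle-point operator. $\operatorname{prox}_\psi(u)=\operatorname{argmin}_{z}\{\psi(z)+\frac12\|u-z\|^2\}$. $\|\cdot\|$ is the Euclidean norm on vectors and the spectral norm on matrices; $\|u\|_\Phi^2=u^\top\Phi u$. A map $\mathcal A:\mathbb{R}^q\to\mathbb{R}^q$ (and the iteration $\omega^{k+1}=\mathcal A(\omega^k)$) is contractive in $\|\cdot\|_\Phi$ ($\Phi\succ0$) with rate $\rho\in[0,1)$ if $\|\mathcal A(\omega)-\mathcal A(\omega')\|_\Phi\le\rho\|\omega-\omega'\|_\Phi$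 for all $\omega,\omega'$. Convention $1/0=+\infty$. $$\Phi_{\tau,\sigma}=\begin{bmatrix}\frac1\tau I_n&-A^\top\\-A&\frac1\sigma I_m\end{bmatrix},\qquad \zeta_{\tau,\sigma}=\max\{\tfrac1\tau,\tfrac1\sigma\}+\|A\|.$$ $R_2,R_3>0$ are constants (independent of $\tau,\sigma$) such that $F$ is $\frac1{R_2}$-inverse Lipschitz under (C2), respectively $\frac1{R_3}$-inverse Lipschitz under (C3), where $F$ is $\frac1R$-inverse Lipschitz if $\|u-u'\|\ge\frac1R\|\omega-\omega'\|$ whenever $u\in F(\omega)$, $u'\in F(\omega')$. Explicitly, with $\mu_f\ge0$ a strong convexity modulus of $f$ ($\mu_f=0$ if $f$ is merely convex): under (C2), $R_2=\frac{1+\alpha\|A\|}{\lambda_{\min}(M_\alpha)}$, $M_\alpha=\begin{bmatrix}\mu_f+\alpha\mu_A&-\frac{\alpha L_g\|A\|}{2}\\-\frac{\alpha L_g\|A\|}{2}&\mu_g\end{bmatrix}$, for a fixed $0<\alpha<\frac{2\mu_A\mu_g+2\sqrt{\mu_A^2\mu_g^2+L_g^2\|A\|^2\mu_g\mu_f}}{L_g^2\|A\|^2}$; under (C3), $R_3=\frac{1+\varepsilon\|A\|}{\varepsilon(\mu_A-\|A\|/(2\delta))}$ for fixed $\delta>\frac{\|A\|}{2\mu_A}$ and $0<\varepsilon<\frac{2}{\max\{L_f,L_g\}\|A\|\delta}$. *)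

theory Defs
  imports "HOL-Analysis.Analysis"
begin

definition edom :: "('a \<Rightarrow> ereal) \<Rightarrow> 'a set"
  where "edom f = {x. f x < \<infinity>}"

definition proper_fun :: "('a \<Rightarrow> ereal) \<Rightarrow> bool"
  where "proper_fun f \<longleftrightarrow> (\<forall>x. f x \<noteq> -\<infinity>) \<and> edom f \<noteq> {}"

text \<open>The library's \<open>epigraph\<close> only covers real-valued functions.\<close>

definition eepigraph :: "('a \<Rightarrow> ereal) \<Rightarrow> ('a \<times> real) set"
  where "eepigraph f = {(x, r). f x \<le> ereal r}"

definition proper_convex_closed :: "('a::real_normed_vector \<Rightarrow> ereal) \<Rightarrow> bool"
  where "proper_convex_closed f \<longleftrightarrow>
    proper_fun f \<and> convex (eepigraph f) \<and> closed (eepigraph f)"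

text \<open>Strong convexity with modulus \<open>\<mu>\<close>; only meant for functions that never
  take the value \<open>-\<infinity>\<close>. In \<^typ>\<open>ereal\<close> we have \<open>0 * \<infinity> = 0\<close>, so the end points
  \<open>t = 0\<close> and \<open>t = 1\<close> are harmless, and \<open>\<mu> = 0\<close> gives plain convexity.\<close>

definition strongly_convex :: "real \<Rightarrow> ('a::real_normed_vector \<Rightarrow> ereal) \<Rightarrow> bool"
  where "strongly_convex \<mu> f \<longleftrightarrow>
    (\<forall>x y t. 0 \<le> t \<and> t \<le> 1 \<longrightarrow>
      f (t *\<^sub>R x + (1 - t) *\<^sub>R y) + ereal (\<mu> / 2 * t * (1 - t) * (norm (x - y))\<^sup>2)
        \<le> ereal t * f x + ereal (1 - t) * f y)"

definition smooth_fun :: "real \<Rightarrow> ('a::real_inner \<Rightarrow> ereal) \<Rightarrow> bool"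
  where "smooth_fun L f \<longleftrightarrow>
    (\<forall>x. \<bar>f x\<bar> \<noteq> \<infinity>) \<and>
    (\<exists>G. (\<forall>x. GDERIV (\<lambda>z. real_of_ereal (f z)) x :> G x) \<and> L-lipschitz_on UNIV G)"

definition subdiff :: "('a::real_inner \<Rightarrow> ereal) \<Rightarrow> 'a \<Rightarrow> 'a set"
  where "subdiff f x = {p. \<forall>z. f x + ereal (p \<bullet> (z - x)) \<le> f z}"

definition prox :: "('a::real_normed_vector \<Rightarrow> ereal) \<Rightarrow> 'a \<Rightarrow> 'a"
  where "prox \<psi> u = arg_min (\<lambda>z. \<psi> z + ereal ((norm (u - z))\<^sup>2 / 2)) (\<lambda>_. True)"

text \<open>The spectral norm; \<^const>\<open>norm\<close> on matrices is the Frobenius norm.\<close>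

definition spectral_norm :: "real^'n^'m \<Rightarrow> real"
  where "spectral_norm A = onorm (\<lambda>x. A *v x)"

text \<open>Smallest eigenvalue; only applied to symmetric matrices, whose set of real
  eigenvalues is finite and nonempty.\<close>

definition lambda_min :: "real^'n^'n \<Rightarrow> real"
  where "lambda_min M = Min {c. \<exists>v. v \<noteq> 0 \<and> M *v v = c *\<^sub>R v}"

definition saddle_solution ::
  "(real^'n \<Rightarrow> ereal) \<Rightarrow> (real^'m \<Rightarrow> ereal) \<Rightarrow> real^'n^'m \<Rightarrow> (real^'n) \<times> (real^'m) \<Rightarrow> bool"
  where "saddle_solution f g A = (\<lambda>(xs, ys).
    xs \<in> edom f \<and> ys \<in> edom g \<and>
    (\<forall>x\<in>edom f. \<forall>y\<in>edom g.
      f xs + ereal (y \<bullet> (A *v xs)) - g y \<le> f xs + ereal (ys \<bullet> (A *v xs)) - g ys \<and>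
      f xs + ereal (ys \<bullet> (A *v xs)) - g ys \<le> f x + ereal (ys \<bullet> (A *v x)) - g ys))"

definition saddle_op ::
  "(real^'n \<Rightarrow> ereal) \<Rightarrow> (real^'m \<Rightarrow> ereal) \<Rightarrow> real^'n^'m
    \<Rightarrow> (real^'n) \<times> (real^'m) \<Rightarrow> ((real^'n) \<times> (real^'m)) set"
  where "saddle_op f g A = (\<lambda>(x, y).
    {(p + transpose A *v y, q - A *v x) | p q. p \<in> subdiff f x \<and> q \<in> subdiff g y})"

definition inverse_lipschitz :: "real \<Rightarrow> ('a::real_normed_vector \<Rightarrow> 'a set) \<Rightarrow> bool"
  where "inverse_lipschitz c F \<longleftrightarrow>
    (\<forall>w w' u u'. u \<in> F w \<and> u' \<in> F w' \<longrightarrow> norm (u - u') \<ge> c * norm (w - w'))"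

definition cp_step ::
  "(real^'n \<Rightarrow> ereal) \<Rightarrow> (real^'m \<Rightarrow> ereal) \<Rightarrow> real^'n^'m \<Rightarrow> real \<Rightarrow> real
    \<Rightarrow> (real^'n) \<times> (real^'m) \<Rightarrow> (real^'n) \<times> (real^'m)"
  where "cp_step f g A \<tau> \<sigma> = (\<lambda>(x, y).
    let x' = prox (\<lambda>z. ereal \<tau> * f z) (x - \<tau> *\<^sub>R (transpose A *v y));
        y' = prox (\<lambda>z. ereal \<sigma> * g z) (y + \<sigma> *\<^sub>R (A *v (2 *\<^sub>R x' - x)))
    in (x', y'))"

definition pos_def_op :: "('a::real_inner \<Rightarrow> 'a) \<Rightarrow> bool"
  where "pos_def_op \<Phi> \<longleftrightarrow>
    linear \<Phi> \<and> (\<forall>u v. \<Phi> u \<bullet> v = u \<bullet> \<Phi> v) \<and> (\<forall>u. u \<noteq> 0 \<longrightarrow> u \<bullet> \<Phi> u > 0)"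

definition norm_op :: "('a::real_inner \<Rightarrow> 'a) \<Rightarrow> 'a \<Rightarrow> real"
  where "norm_op \<Phi> u = sqrt (u \<bullet> \<Phi> u)"

definition contractive_in :: "('a::real_inner \<Rightarrow> 'a) \<Rightarrow> real \<Rightarrow> ('a \<Rightarrow> 'a) \<Rightarrow> bool"
  where "contractive_in \<Phi> \<rho> T \<longleftrightarrow>
    pos_def_op \<Phi> \<and> 0 \<le> \<rho> \<and> \<rho> < 1 \<and>
    (\<forall>w w'. norm_op \<Phi> (T w - T w') \<le> \<rho> * norm_op \<Phi> (w - w'))"

text \<open>The block matrix with rows \<open>(1/\<tau> I, -A\<^sup>T)\<close> and \<open>(-A, 1/\<sigma> I)\<close>, as a linear
  operator on the product space, whose norm is the Euclidean one.\<close>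

definition Phi :: "real^'n^'m \<Rightarrow> real \<Rightarrow> real
    \<Rightarrow> (real^'n) \<times> (real^'m) \<Rightarrow> (real^'n) \<times> (real^'m)"
  where "Phi A \<tau> \<sigma> = (\<lambda>(x, y).
    ((1 / \<tau>) *\<^sub>R x - transpose A *v y, - (A *v x) + (1 / \<sigma>) *\<^sub>R y))"

definition zeta :: "real^'n^'m \<Rightarrow> real \<Rightarrow> real \<Rightarrow> real"
  where "zeta A \<tau> \<sigma> = max (1 / \<tau>) (1 / \<sigma>) + spectral_norm A"

definition admissible :: "real^'n^'m \<Rightarrow> real \<Rightarrow> real \<times> real \<Rightarrow> bool"
  where "admissible A \<epsilon> = (\<lambda>(\<tau>, \<sigma>).
    0 < \<tau> \<and> 0 < \<sigma> \<and> \<tau> * \<sigma> * (spectral_norm A)\<^sup>2 * (1 + \<epsilon>)\<^sup>2 \<le> 1)"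

definition cond_C1 ::
  "(real^'n \<Rightarrow> ereal) \<Rightarrow> (real^'m \<Rightarrow> ereal) \<Rightarrow> real \<Rightarrow> real \<Rightarrow> bool"
  where "cond_C1 f g \<mu>f \<mu>g \<longleftrightarrow>
    \<mu>f > 0 \<and> \<mu>g > 0 \<and> strongly_convex \<mu>f f \<and> strongly_convex \<mu>g g"

definition cond_C2 ::
  "(real^'m \<Rightarrow> ereal) \<Rightarrow> real^'n^'m \<Rightarrow> real \<Rightarrow> real \<Rightarrow> real \<Rightarrow> bool"
  where "cond_C2 g A \<mu>g Lg \<mu>A \<longleftrightarrow>
    \<mu>g > 0 \<and> Lg > 0 \<and> strongly_convex \<mu>g g \<and> smooth_fun Lg g \<and>
    \<mu>A = lambda_min (transpose A ** A) \<and> \<mu>A > 0"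

definition cond_C3 ::
  "(real^'n \<Rightarrow> ereal) \<Rightarrow> (real^'m \<Rightarrow> ereal) \<Rightarrow> real^'n^'m \<Rightarrow> real \<Rightarrow> real \<Rightarrow> real \<Rightarrow> bool"
  where "cond_C3 f g A Lf Lg \<mu>A \<longleftrightarrow>
    Lf \<ge> 0 \<and> Lg \<ge> 0 \<and> smooth_fun Lf f \<and> smooth_fun Lg g \<and> CARD('n) = CARD('m) \<and>
    \<mu>A = lambda_min (transpose A ** A) \<and> \<mu>A = lambda_min (A ** transpose A) \<and> \<mu>A > 0"

definition kappa :: "real^'n^'m \<Rightarrow> real \<Rightarrow> real \<Rightarrow> real \<Rightarrow> real \<Rightarrow> real"
  where "kappa A \<mu>f \<mu>g \<tau> \<sigma> =
    (\<mu>f * \<tau> + \<mu>g * \<sigma>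
      - sqrt ((\<mu>f * \<tau> - \<mu>g * \<sigma>)\<^sup>2 + 4 * (spectral_norm A)\<^sup>2 * \<mu>f * \<mu>g * \<tau>\<^sup>2 * \<sigma>\<^sup>2))
    / (2 * (1 - \<sigma> * \<tau> * (spectral_norm A)\<^sup>2))"

definition rate1 :: "real^'n^'m \<Rightarrow> real \<Rightarrow> real \<Rightarrow> real \<Rightarrow> real \<Rightarrow> real"
  where "rate1 A \<mu>f \<mu>g \<tau> \<sigma> =
    inverse (1 + min (min (\<mu>f * \<tau>) (\<mu>g * \<sigma>)) (kappa A \<mu>f \<mu>g \<tau> \<sigma>))"

definition rate23 :: "real^'n^'m \<Rightarrow> real \<Rightarrow> real \<Rightarrow> real \<Rightarrow> real"
  where "rate23 A R \<tau> \<sigma> = (R * zeta A \<tau> \<sigma>) / sqrt ((R * zeta A \<tau> \<sigma>)\<^sup>2 + 1)"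

definition M_alpha :: "real^'n^'m \<Rightarrow> real \<Rightarrow> real \<Rightarrow> real \<Rightarrow> real \<Rightarrow> real \<Rightarrow> real^2^2"
  where "M_alpha A \<mu>f \<mu>g Lg \<mu>A \<alpha> = vector
    [vector [\<mu>f + \<alpha> * \<mu>A, - (\<alpha> * Lg * spectral_norm A / 2)],
     vector [- (\<alpha> * Lg * spectral_norm A / 2), \<mu>g]]"

definition admissible_alpha :: "real^'n^'m \<Rightarrow> real \<Rightarrow> real \<Rightarrow> real \<Rightarrow> real \<Rightarrow> real \<Rightarrow> bool"
  where "admissible_alpha A \<mu>f \<mu>g Lg \<mu>A \<alpha> \<longleftrightarrow>
    0 < \<alpha> \<and>
    \<alpha> < (2 * \<mu>A * \<mu>g + 2 * sqrt (\<mu>A\<^sup>2 * \<mu>g\<^sup>2 + Lg\<^sup>2 * (spectral_norm A)\<^sup>2 * \<mu>g * \<mu>f))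
        / (Lg\<^sup>2 * (spectral_norm A)\<^sup>2)"

definition R2 :: "real^'n^'m \<Rightarrow> real \<Rightarrow> real \<Rightarrow> real \<Rightarrow> real \<Rightarrow> real \<Rightarrow> real"
  where "R2 A \<mu>f \<mu>g Lg \<mu>A \<alpha> =
    (1 + \<alpha> * spectral_norm A) / lambda_min (M_alpha A \<mu>f \<mu>g Lg \<mu>A \<alpha>)"

text \<open>The upper bound on \<open>\<epsilon>'\<close> is taken in \<^typ>\<open>ereal\<close>, where \<open>2 / 0 = \<infinity>\<close>: there is no upper
  bound when both smoothness constants vanish.\<close>

definition admissible_delta_eps :: "real^'n^'m \<Rightarrow> real \<Rightarrow> real \<Rightarrow> real \<Rightarrow> real \<Rightarrow> real \<Rightarrow> bool"
  where "admissible_delta_eps A Lf Lg \<mu>A \<delta> \<epsilon>' \<longleftrightarrow>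
    \<delta> > spectral_norm A / (2 * \<mu>A) \<and>
    0 < \<epsilon>' \<and> ereal \<epsilon>' < ereal 2 / ereal (max Lf Lg * spectral_norm A * \<delta>)"

definition R3 :: "real^'n^'m \<Rightarrow> real \<Rightarrow> real \<Rightarrow> real \<Rightarrow> real"
  where "R3 A \<mu>A \<delta> \<epsilon>' =
    (1 + \<epsilon>' * spectral_norm A) / (\<epsilon>' * (\<mu>A - spectral_norm A / (2 * \<delta>)))"

end

theory Submission
  imports Defs
begin

text \<open>
  Write \<open>T\<close> for the iteration, \<open>F\<close> for the saddle-point operator and \<open>\<Phi>\<close> for \<open>\<Phi>\<^bsub>\<tau>,\<sigma>\<^esub>\<close>. The
  optimality conditions of the two proximal steps say exactly that \<open>\<Phi> (w - T w) \<in> F (T w)\<close>, so \<open>T\<close>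
  is a proximal point step for \<open>F\<close> in the metric \<open>\<Phi>\<close>. Put \<open>d = w - w'\<close> and \<open>e = T w - T w'\<close>; then
  \<open>\<Phi> (d - e)\<close> is a difference of elements of \<open>F (T w)\<close> and \<open>F (T w')\<close>.

  If \<open>F\<close> is strongly monotone, \<open>e \<bullet> \<Phi> (d - e)\<close> dominates \<open>\<mu>f |e\<^sub>x|\<^sup>2 + \<mu>g |e\<^sub>y|\<^sup>2 \<ge> c |e|\<^sub>\<Phi>\<^sup>2\<close> as soon as
  \<open>diag (\<mu>f, \<mu>g) - c \<Phi>\<close> is positive semidefinite; \<open>\<kappa>\<close> is the smaller root of the resulting
  determinant condition. Cauchy-Schwarz in \<open>\<Phi>\<close> gives the rate \<open>1 / (1 + c)\<close>.

  If \<open>F\<close> is only monotone and \<open>1/R\<close>-inverse Lipschitz, then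
  \<open>|e|\<^sub>\<Phi>\<^sup>2 \<le> \<zeta> |e|\<^sup>2 \<le> \<zeta> R\<^sup>2 |\<Phi> (d - e)|\<^sup>2 \<le> (\<zeta> R)\<^sup>2 |d - e|\<^sub>\<Phi>\<^sup>2\<close>, while monotonicity gives
  \<open>|e|\<^sub>\<Phi>\<^sup>2 + |d - e|\<^sub>\<Phi>\<^sup>2 \<le> |d|\<^sub>\<Phi>\<^sup>2\<close>. The inverse Lipschitz property itself comes from pairing a
  difference \<open>u\<close> of values of \<open>F\<close> at points with difference \<open>(x, y)\<close> with the test vectors
  \<open>(x, y - \<alpha> A x)\<close> and \<open>(x + \<epsilon> A\<^sup>T y, y - \<epsilon> A x)\<close>, respectively.
\<close>

section \<open>Subdifferentials and proximal maps\<close>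

text \<open>The limit t -> 0 in disguise: in the first-order arguments below it discards the term of
  higher order that is left after division by t.\<close>

lemma nonneg_perturbation_limit:
  fixes a b :: real
  assumes "\<And>t. 0 < t \<Longrightarrow> t < 1 \<Longrightarrow> a \<le> t * b"
  shows "a \<le> 0"
proof (rule ccontr)
  assume "\<not> a \<le> 0"
  hence a: "a > 0" by simp
  \<comment> \<open>This t makes \<open>t * (a + \<bar>b\<bar>)\<close> equal to a / 2, so that t *
    b stays below a.\<close>
  define t where "t = a / (2 * (a + \<bar>b\<bar>))"
  have t: "0 < t" "t < 1" using a by (auto simp: t_def field_simps)
  have "t * b \<le> t * \<bar>b\<bar>" using t by (intro mult_left_mono) auto
  also have "\<dots> \<le> t * (a + \<bar>b\<bar>)" using t a by (intro mult_left_mono) auto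
  also have "\<dots> = a / 2" using a by (simp add: t_def field_simps)
  finally show False using assms[OF t] a by simp
qed

lemma subdiff_finite:
  assumes "proper_fun f" "p \<in> subdiff f x"
  shows "\<bar>f x\<bar> \<noteq> \<infinity>"
proof -
  obtain z where "f z < \<infinity>" using assms(1) by (auto simp: proper_fun_def edom_def)
  moreover have "f x + ereal (p \<bullet> (z - x)) \<le> f z" using assms(2) by (auto simp: subdiff_def)
  ultimately have "f x \<noteq> \<infinity>" by auto
  thus ?thesis using assms(1) by (auto simp: proper_fun_def)
qed

text \<open>Where f is +\<infinity> the inequality holds trivially, and -\<infinity> is excluded, so
  testing against finite values loses nothing and the later arguments become real
  arithmetic.\<close>

lemma subdiff_iff_real:
  assumes "proper_fun f" "f x = ereal a"
  shows "p \<in> subdiff f x \<longleftrightarrow> (\<forall>z b. f z = ereal b \<longrightarrow> a + p \<bullet> (z - x) \<le> b)"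
proof
  assume *: "p \<in> subdiff f x"
  show "\<forall>z b. f z = ereal b \<longrightarrow> a + p \<bullet> (z - x) \<le> b"
  proof (intro allI impI)
    fix z b assume "f z = ereal b"
    moreover have "f x + ereal (p \<bullet> (z - x)) \<le> f z" using * by (auto simp: subdiff_def)
    ultimately show "a + p \<bullet> (z - x) \<le> b" using assms by simp
  qed
next
  assume *: "\<forall>z b. f z = ereal b \<longrightarrow> a + p \<bullet> (z - x) \<le> b"
  show "p \<in> subdiff f x" unfolding subdiff_def
  proof safe
    fix z
    show "f x + ereal (p \<bullet> (z - x)) \<le> f z"
      using * assms by (cases "f z") (auto simp: proper_fun_def)
  qed
qed

lemma subdiff_monotone:
  assumes "proper_fun f" "p \<in> subdiff f x" "p' \<in> subdiff f x'"
  shows "0 \<le> (p - p') \<bullet> (x - x')"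
proof -
  obtain a b where ab: "f x = ereal a" "f x' = ereal b"
    using subdiff_finite[OF assms(1)] assms by (metis abs_ereal.simps(2,3) real_of_ereal.cases)
  have "a + p \<bullet> (x' - x) \<le> b" "b + p' \<bullet> (x - x') \<le> a"
    using assms ab subdiff_iff_real by blast+
  thus ?thesis by (simp add: inner_diff_left inner_diff_right)
qed

text \<open>The subgradient inequality at a point of the segment from x to z meets the upper bound
  from strong convexity there; division by t and t -> 0 leave the full quadratic term.\<close>

lemma subdiff_strongly_convex_lower:
  assumes "proper_fun f" "strongly_convex \<mu> f" "p \<in> subdiff f x" "f x = ereal a" "f z = ereal b"
  shows "a + p \<bullet> (z - x) + \<mu> / 2 * (norm (z - x))\<^sup>2 \<le> b"
proof -
  define D where "D = p \<bullet> (z - x)"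
  define N where "N = (norm (z - x))\<^sup>2"
  have "a + D + \<mu> / 2 * N - b \<le> t * (\<mu> / 2 * N)" if t: "0 < t" "t < 1" for t
  proof -
    let ?w = "t *\<^sub>R z + (1 - t) *\<^sub>R x"
    have w: "f ?w + ereal (\<mu> / 2 * t * (1 - t) * N) \<le> ereal (t * b + (1 - t) * a)"
      using assms(2,4,5) t unfolding strongly_convex_def N_def
      by (metis less_imp_le times_ereal.simps(1) plus_ereal.simps(1))
    then obtain c where c: "f ?w = ereal c"
      using assms(1) by (cases "f ?w") (auto simp: proper_fun_def)
    have "a + p \<bullet> (?w - x) \<le> c" using assms c subdiff_iff_real by blast
    moreover have "?w - x = t *\<^sub>R (z - x)" by (simp add: algebra_simps)
    ultimately have "a + t * D \<le> c" by (simp add: D_def)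
    hence "a + t * D + \<mu> / 2 * t * (1 - t) * N \<le> t * b + (1 - t) * a" using w c by simp
    hence "t * (a + D + \<mu> / 2 * (1 - t) * N - b) \<le> 0" by (simp add: algebra_simps)
    hence "a + D + \<mu> / 2 * (1 - t) * N - b \<le> 0" using t by (simp add: mult_le_0_iff)
    thus ?thesis by (simp add: field_simps)
  qed
  from nonneg_perturbation_limit[OF this] show ?thesis by (simp add: D_def N_def)
qed

text \<open>The quadratic lower bounds at the two points are added: the values cancel and the two
  halves of \<mu> combine.\<close>

lemma subdiff_strongly_monotone:
  assumes "proper_fun f" "strongly_convex \<mu> f" "p \<in> subdiff f x" "p' \<in> subdiff f x'"
  shows "\<mu> * (norm (x - x'))\<^sup>2 \<le> (p - p') \<bullet> (x - x')"
proof -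
  obtain a b where ab: "f x = ereal a" "f x' = ereal b"
    using subdiff_finite[OF assms(1)] assms by (metis abs_ereal.simps(2,3) real_of_ereal.cases)
  have "a + p \<bullet> (x' - x) + \<mu> / 2 * (norm (x' - x))\<^sup>2 \<le> b"
       "b + p' \<bullet> (x - x') + \<mu> / 2 * (norm (x - x'))\<^sup>2 \<le> a"
    using assms ab subdiff_strongly_convex_lower by blast+
  thus ?thesis by (simp add: inner_diff_left inner_diff_right norm_minus_commute)
qed

section \<open>Existence and characterization of proximal points\<close>

text \<open>A hyperplane strictly separates the closed convex epigraph from a point just below the
  graph. Comparison with the graph point directly above shows the vertical component s to be
  positive, so division by s yields an affine function.\<close>

lemma affine_minorant:
  fixes f :: "'a::euclidean_space \<Rightarrow> ereal"
  assumes "proper_convex_closed f"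
  shows "\<exists>q c. \<forall>z r. (z, r) \<in> eepigraph f \<longrightarrow> c + q \<bullet> z \<le> r"
proof -
  have E: "convex (eepigraph f)" "closed (eepigraph f)" "proper_fun f"
    using assms by (auto simp: proper_convex_closed_def)
  obtain z0 where "f z0 < \<infinity>" using E(3) by (auto simp: proper_fun_def edom_def)
  then obtain r0 where r0: "f z0 = ereal r0"
    using E(3) by (cases "f z0") (auto simp: proper_fun_def)
  have "(z0, r0 - 1) \<notin> eepigraph f" by (simp add: eepigraph_def r0)
  from separating_hyperplane_closed_point[OF E(1,2) this]
  obtain h b where h: "h \<bullet> (z0, r0 - 1) < b" "\<And>e. e \<in> eepigraph f \<Longrightarrow> b < h \<bullet> e" by blast
  obtain p s where ps: "h = (p, s)" by (cases h)
  have "(z0, r0) \<in> eepigraph f" by (simp add: eepigraph_def r0)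
  from h(2)[OF this] h(1) have s: "s > 0" by (simp add: ps algebra_simps)
  show ?thesis
  proof (intro exI allI impI)
    fix z r assume "(z, r) \<in> eepigraph f"
    from h(2)[OF this] have "b < p \<bullet> z + s * r" by (simp add: ps)
    thus "b / s + (- (1 / s) *\<^sub>R p) \<bullet> z \<le> r" using s by (simp add: field_simps)
  qed
qed

text \<open>The minimum is sought over the epigraph, where the objective is continuous and where
  lower semicontinuity of f appears as closedness. The quadratic term dominates the affine minorant,
  so the sublevel set K is compact.\<close>

lemma prox_objective_attains_min:
  fixes f :: "'a::euclidean_space \<Rightarrow> ereal"
  assumes f: "proper_convex_closed f" and \<tau>: "0 < \<tau>"
  obtains z a where "f z = ereal a"
    "\<And>w b. f w = ereal b \<Longrightarrow> \<tau> * a + (norm (u - z))\<^sup>2 / 2 \<le> \<tau> * b + (norm (u - w))\<^sup>2 / 2"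
proof -
  have E: "closed (eepigraph f)" "proper_fun f"
    using assms by (auto simp: proper_convex_closed_def)
  obtain q c where qc: "\<And>z r. (z, r) \<in> eepigraph f \<Longrightarrow> c + q \<bullet> z \<le> r"
    using affine_minorant[OF f] by meson
  obtain z0 where "f z0 < \<infinity>" using E(2) by (auto simp: proper_fun_def edom_def)
  then obtain r0 where r0: "f z0 = ereal r0"
    using E(2) by (cases "f z0") (auto simp: proper_fun_def)
  define h where "h = (\<lambda>(z, r). \<tau> * r + (norm (u - z))\<^sup>2 / 2)"
  have cont: "continuous_on S h" for S
    unfolding h_def case_prod_beta by (intro continuous_intros) auto
  define C where "C = h (z0, r0)"
  define K where "K = eepigraph f \<inter> {e. h e \<le> C}"
  have z0K: "(z0, r0) \<in> K" by (simp add: K_def C_def eepigraph_def r0)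
  have "closed K" unfolding K_def
    by (intro closed_Int E closed_Collect_le cont continuous_on_const)
  moreover have "bounded K"
  proof -
    \<comment> \<open>With d = |u - z| the minorant gives d^2 <= 2 Y + 2 k d. Completing the square
      yields (d - k)^2 <= S, and S <= (S + 1)^2 gives d <= k + S + 1 without a square root; B1
      bounds the norm of z accordingly.\<close>
    define k where "k = \<tau> * norm q"
    define Y where "Y = \<bar>C - \<tau> * c\<bar> + \<tau> * \<bar>q \<bullet> u\<bar>"
    have Y: "C - \<tau> * c + \<tau> * \<bar>q \<bullet> u\<bar> \<le> Y" "0 \<le> Y" using \<tau> by (auto simp: Y_def)
    define S where "S = 2 * Y + k\<^sup>2"
    define B1 where "B1 = norm u + (k + S + 1)"
    have "norm e \<le> B1 + (\<bar>C / \<tau>\<bar> + \<bar>c\<bar> + norm q * B1)" if e: "e \<in> K" for e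
    proof -
      obtain z r where zr: "e = (z, r)" by (cases e)
      have hz: "\<tau> * r + (norm (u - z))\<^sup>2 / 2 \<le> C" and m: "c + q \<bullet> z \<le> r"
        using e qc by (auto simp: K_def zr h_def)
      define d where "d = norm (u - z)"
      have d0: "d \<ge> 0" by (simp add: d_def)
      have "q \<bullet> z = q \<bullet> u - q \<bullet> (u - z)" by (simp add: inner_diff_right)
      moreover have "q \<bullet> (u - z) \<le> norm q * d" unfolding d_def by (rule norm_cauchy_schwarz)
      ultimately have "c - \<bar>q \<bullet> u\<bar> - norm q * d \<le> r" using m by linarith
      hence "\<tau> * (c - \<bar>q \<bullet> u\<bar> - norm q * d) \<le> \<tau> * r" using \<tau> by simp
      hence "d\<^sup>2 \<le> 2 * (C - \<tau> * c + \<tau> * \<bar>q \<bullet> u\<bar>) + 2 * d * k"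
        using hz unfolding d_def[symmetric] k_def by (simp add: algebra_simps)
      hence "(d - k)\<^sup>2 \<le> S"
        unfolding S_def power2_diff using mult_left_mono[OF Y(1), of 2] by argo
      also have "S \<le> (S + 1)\<^sup>2"
        using Y(2) by (simp add: S_def power2_sum)
      finally have "d - k \<le> S + 1"
        by (rule power2_le_imp_le) (use Y(2) in \<open>simp add: S_def\<close>)
      hence z: "norm z \<le> B1"
        unfolding B1_def d_def using norm_triangle_ineq2[of z u] by (simp add: norm_minus_commute)
      have "\<tau> * r \<le> C" using hz by (smt (verit) divide_nonneg_pos zero_le_power2)
      hence "r \<le> C / \<tau>" using \<tau> by (simp add: field_simps)
      moreover have "\<bar>q \<bullet> z\<bar> \<le> norm q * B1"
        using Cauchy_Schwarz_ineq2[of q z] z by (meson mult_left_mono norm_ge_zero order_trans)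
      ultimately have "\<bar>r\<bar> \<le> \<bar>C / \<tau>\<bar> + \<bar>c\<bar> + norm q * B1"
        using m by linarith
      thus ?thesis using z norm_Pair_le[of z r] by (simp add: zr)
    qed
    thus ?thesis unfolding bounded_iff by blast
  qed
  ultimately have "compact K" by (simp add: compact_eq_bounded_closed)
  then obtain e where e: "e \<in> K" "\<And>e'. e' \<in> K \<Longrightarrow> h e \<le> h e'"
    using continuous_attains_inf[of K h] cont z0K by (metis empty_iff)
  obtain z r where zr: "e = (z, r)" by (cases e)
  have "f z \<le> ereal r" using e(1) by (simp add: zr K_def eepigraph_def)
  then obtain a where a: "f z = ereal a" "a \<le> r"
    using E(2) by (cases "f z") (auto simp: proper_fun_def)
  show thesis
  proof (rule that[OF a(1)])
    fix w b assume w: "f w = ereal b"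
    have "h e \<le> h (w, b)"
    proof (cases "h (w, b) \<le> C")
      case True
      thus ?thesis by (intro e(2)) (simp add: K_def eepigraph_def w)
    next
      case False
      thus ?thesis using e(2)[OF z0K] by (simp add: C_def)
    qed
    moreover have "\<tau> * a \<le> \<tau> * r" using a \<tau> by simp
    ultimately show "\<tau> * a + (norm (u - z))\<^sup>2 / 2 \<le> \<tau> * b + (norm (u - w))\<^sup>2 / 2"
      by (simp add: h_def zr)
  qed
qed

text \<open>The minimizer is compared with points at fraction t of the way to w, where convexity
  bounds f from above; the terms of order t give the inequality once t tends to 0.\<close>

lemma prox_variational_ineq:
  fixes f :: "'a::euclidean_space \<Rightarrow> ereal"
  assumes f: "proper_convex_closed f" and \<tau>: "0 < \<tau>" and z: "f z = ereal a"
    and min: "\<And>w b. f w = ereal b \<Longrightarrow>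
      \<tau> * a + (norm (u - z))\<^sup>2 / 2 \<le> \<tau> * b + (norm (u - w))\<^sup>2 / 2"
  shows "(1 / \<tau>) *\<^sub>R (u - z) \<in> subdiff f z"
proof -
  have E: "convex (eepigraph f)" "proper_fun f"
    using assms by (auto simp: proper_convex_closed_def)
  show ?thesis unfolding subdiff_iff_real[OF E(2) z]
  proof (intro allI impI)
    fix w b assume w: "f w = ereal b"
    define D where "D = (u - z) \<bullet> (w - z)"
    define N where "N = (norm (w - z))\<^sup>2"
    have "D - \<tau> * (b - a) \<le> t * (N / 2)" if t: "0 < t" "t < 1" for t
    proof -
      let ?w = "(1 - t) *\<^sub>R z + t *\<^sub>R w"
      have "(1 - t) *\<^sub>R (z, a) + t *\<^sub>R (w, b) \<in> eepigraph f"
        using t z w by (intro convexD[OF E(1)]) (auto simp: eepigraph_def)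
      hence fw: "f ?w \<le> ereal ((1 - t) * a + t * b)" by (simp add: eepigraph_def)
      then obtain r where r: "f ?w = ereal r"
        using E(2) by (cases "f ?w") (auto simp: proper_fun_def)
      have "\<tau> * r \<le> \<tau> * ((1 - t) * a + t * b)" using fw r \<tau> by simp
      moreover have "u - ?w = (u - z) - t *\<^sub>R (w - z)" by (simp add: algebra_simps)
      hence "(norm (u - ?w))\<^sup>2 = (norm (u - z))\<^sup>2 - 2 * t * D + t\<^sup>2 * N"
        unfolding D_def N_def power2_norm_eq_inner
        by (simp add: inner_diff_left inner_diff_right inner_commute power2_eq_square algebra_simps)
      ultimately have "\<tau> * a \<le> \<tau> * ((1 - t) * a + t * b) - t * D + t\<^sup>2 * N / 2"
        using min[OF r] by (simp add: field_simps)
      hence "t * (D - \<tau> * (b - a)) \<le> t * (t * (N / 2))"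
        by (simp add: algebra_simps power2_eq_square)
      thus ?thesis using t by simp
    qed
    from nonneg_perturbation_limit[OF this] have "a + 1 / \<tau> * D \<le> b"
      using \<tau> by (simp add: field_simps)
    thus "a + (1 / \<tau>) *\<^sub>R (u - z) \<bullet> (w - z) \<le> b"
      by (simp add: D_def)
  qed
qed

text \<open>The subgradient inequality and the expansion of |u - w|^2 show that the objective at w
  exceeds that at z by at least |w - z|^2 / 2. The minimizer is therefore unique, which fixes the
  choice made by \<open>arg_min\<close>.\<close>

lemma prox_eqI:
  fixes f :: "'a::euclidean_space \<Rightarrow> ereal"
  assumes f: "proper_fun f" and \<tau>: "0 < \<tau>" and p: "(1 / \<tau>) *\<^sub>R (u - z) \<in> subdiff f z"
  shows "prox (\<lambda>z. ereal \<tau> * f z) u = z"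
proof -
  let ?h = "\<lambda>z. ereal \<tau> * f z + ereal ((norm (u - z))\<^sup>2 / 2)"
  obtain a where a: "f z = ereal a" using subdiff_finite[OF f p] by (cases "f z") auto
  have less: "?h z < ?h w" if "w \<noteq> z" for w
  proof (cases "f w")
    case (real b)
    define D where "D = (u - z) \<bullet> (w - z)"
    have "a + (1 / \<tau>) *\<^sub>R (u - z) \<bullet> (w - z) \<le> b"
      using p real unfolding subdiff_iff_real[OF f a] by blast
    hence "a + 1 / \<tau> * D \<le> b" by (simp add: D_def)
    hence "\<tau> * a + D \<le> \<tau> * b" using \<tau> by (simp add: field_simps)
    moreover have "u - w = (u - z) - (w - z)" by simp
    hence "(norm (u - w))\<^sup>2 = (norm (u - z))\<^sup>2 - 2 * D + (norm (w - z))\<^sup>2"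
      unfolding D_def power2_norm_eq_inner
      by (simp add: inner_diff_left inner_diff_right inner_commute algebra_simps)
    moreover have "(norm (w - z))\<^sup>2 > 0" using that by simp
    ultimately have "\<tau> * a + (norm (u - z))\<^sup>2 / 2 < \<tau> * b + (norm (u - w))\<^sup>2 / 2" by argo
    thus ?thesis by (simp add: a real)
  qed (use \<tau> f a in \<open>auto simp: proper_fun_def\<close>)
  show ?thesis unfolding prox_def arg_min_def
  proof (rule some_equality)
    show "is_arg_min ?h (\<lambda>_. True) z" unfolding is_arg_min_def
      using less by (metis order.asym order.irrefl)
    show "w = z" if "is_arg_min ?h (\<lambda>_. True) w" for w
      using that less unfolding is_arg_min_def by blast
  qed
qed

text \<open>Attainment provides some z' satisfying the inclusion. By \<open>prox_eqI\<close> every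
  point satisfying it equals the proximal value, and both directions follow.\<close>

lemma prox_eq_iff:
  fixes f :: "'a::euclidean_space \<Rightarrow> ereal"
  assumes f: "proper_convex_closed f" and \<tau>: "0 < \<tau>"
  shows "prox (\<lambda>z. ereal \<tau> * f z) u = z \<longleftrightarrow> (1 / \<tau>) *\<^sub>R (u - z) \<in> subdiff f z"
proof -
  have pf: "proper_fun f" using f by (simp add: proper_convex_closed_def)
  obtain z' a where "f z' = ereal a"
    "\<And>w b. f w = ereal b \<Longrightarrow> \<tau> * a + (norm (u - z'))\<^sup>2 / 2 \<le> \<tau> * b + (norm (u - w))\<^sup>2 / 2"
    using prox_objective_attains_min[OF f \<tau>] by blast
  from prox_variational_ineq[OF f \<tau> this] have "(1 / \<tau>) *\<^sub>R (u - z') \<in> subdiff f z'" .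
  thus ?thesis using prox_eqI[OF pf \<tau>] by metis
qed

section \<open>Saddle points as pairs of subgradient conditions\<close>

text \<open>One of the two saddle inequalities varies only y, the other only x, and each is an
  optimality condition in its own variable.\<close>

lemma saddle_solution_iff_subdiff:
  assumes f: "proper_fun f" and g: "proper_fun g"
  shows "saddle_solution f g A (x, y) \<longleftrightarrow>
    - (transpose A *v y) \<in> subdiff f x \<and> A *v x \<in> subdiff g y"
proof -
  have dom: "z \<in> edom h \<longleftrightarrow> (\<exists>r. h z = ereal r)" if "proper_fun h" for h :: "'z \<Rightarrow> ereal" and z
    using that by (cases "h z") (auto simp: edom_def proper_fun_def)
  show ?thesis
  proof (cases "x \<in> edom f \<and> y \<in> edom g")
    case False
    moreover have "x \<in> edom f" if "p \<in> subdiff f x" for p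
      using subdiff_finite[OF f that] by (auto simp: edom_def)
    moreover have "y \<in> edom g" if "p \<in> subdiff g y" for p
      using subdiff_finite[OF g that] by (auto simp: edom_def)
    ultimately show ?thesis by (auto simp: saddle_solution_def)
  next
    case True
    then obtain a b where ab: "f x = ereal a" "g y = ereal b" by (auto simp: dom f g)
    have adj: "(transpose A *v y) \<bullet> v = y \<bullet> (A *v v)" for v
      by (simp add: dot_lmul_matrix)
    have "saddle_solution f g A (x, y) \<longleftrightarrow>
        (\<forall>z r w s. f z = ereal r \<and> g w = ereal s \<longrightarrow>
          w \<bullet> (A *v x) - s \<le> y \<bullet> (A *v x) - b \<and> a + y \<bullet> (A *v x) \<le> r + y \<bullet> (A *v z))"
      (is "_ \<longleftrightarrow> (\<forall>z r w s. ?P z r w s)")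
    proof
      assume S: "saddle_solution f g A (x, y)"
      show "\<forall>z r w s. ?P z r w s"
      proof (intro allI impI, elim conjE)
        fix z r w s assume "f z = ereal r" "g w = ereal s"
        moreover from this have "z \<in> edom f" "w \<in> edom g" by (auto simp: dom f g)
        hence "f x + ereal (w \<bullet> (A *v x)) - g w \<le> f x + ereal (y \<bullet> (A *v x)) - g y \<and>
            f x + ereal (y \<bullet> (A *v x)) - g y \<le> f z + ereal (y \<bullet> (A *v z)) - g y"
          using S by (simp add: saddle_solution_def)
        ultimately show "w \<bullet> (A *v x) - s \<le> y \<bullet> (A *v x) - b \<and>
            a + y \<bullet> (A *v x) \<le> r + y \<bullet> (A *v z)"
          using ab by simp
      qed
    next
      assume P: "\<forall>z r w s. ?P z r w s"
      show "saddle_solution f g A (x, y)" unfolding saddle_solution_def split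
      proof (intro conjI ballI True[THEN conjunct1] True[THEN conjunct2])
        fix z w assume "z \<in> edom f" "w \<in> edom g"
        then obtain r s where "f z = ereal r" "g w = ereal s" by (auto simp: dom f g)
        thus "f x + ereal (w \<bullet> (A *v x)) - g w \<le> f x + ereal (y \<bullet> (A *v x)) - g y"
          "f x + ereal (y \<bullet> (A *v x)) - g y \<le> f z + ereal (y \<bullet> (A *v z)) - g y"
          using P ab by fastforce+
      qed
    qed
    \<comment> \<open>Each conclusion concerns only one of the two points; instantiating the other
      at x or y, where the values are finite, separates the quantifiers.\<close>
    also have "\<dots> \<longleftrightarrow>
        (\<forall>z r. f z = ereal r \<longrightarrow> a + y \<bullet> (A *v x) \<le> r + y \<bullet> (A *v z)) \<and>
        (\<forall>w s. g w = ereal s \<longrightarrow> w \<bullet> (A *v x) - s \<le> y \<bullet> (A *v x) - b)"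
      using ab by blast
    also have "\<dots> \<longleftrightarrow> - (transpose A *v y) \<in> subdiff f x \<and> A *v x \<in> subdiff g y"
      unfolding subdiff_iff_real[OF f ab(1)] subdiff_iff_real[OF g ab(2)]
      by (simp add: adj inner_diff_right matrix_vector_mult_diff_distrib algebra_simps
          del: transpose_matrix_vector) (simp add: inner_commute)
    finally show ?thesis .
  qed
qed

section \<open>Symmetric operators and smallest eigenvalues\<close>

text \<open>Stated for semidefinite operators because it is applied to a shift of a matrix that
  annihilates an eigenvector. Both diagonal values may then vanish, and this case is treated
  apart.\<close>

lemma psd_Cauchy_Schwarz:
  fixes \<Phi> :: "'a::real_inner \<Rightarrow> 'a"
  assumes lin: "linear \<Phi>" and sym: "\<And>u v. \<Phi> u \<bullet> v = u \<bullet> \<Phi> v"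
    and psd: "\<And>u. 0 \<le> u \<bullet> \<Phi> u"
  shows "(u \<bullet> \<Phi> v)\<^sup>2 \<le> (u \<bullet> \<Phi> u) * (v \<bullet> \<Phi> v)"
proof -
  define a b c where "a = u \<bullet> \<Phi> u" and "b = u \<bullet> \<Phi> v" and "c = v \<bullet> \<Phi> v"
  have vu: "v \<bullet> \<Phi> u = b" unfolding b_def by (metis sym inner_commute)
  have quad: "0 \<le> s\<^sup>2 * a + 2 * s * t * b + t\<^sup>2 * c" for s t
  proof -
    have "0 \<le> (s *\<^sub>R u + t *\<^sub>R v) \<bullet> \<Phi> (s *\<^sub>R u + t *\<^sub>R v)" by (rule psd)
    also have "\<dots> = s\<^sup>2 * a + 2 * s * t * b + t\<^sup>2 * c"
      by (simp add: linear_add[OF lin] linear_scale[OF lin] inner_add_left inner_add_right vu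
          flip: a_def b_def c_def) (simp add: power2_eq_square algebra_simps)
    finally show ?thesis .
  qed
  have c0: "0 \<le> c" and a0: "0 \<le> a" using psd by (auto simp: a_def c_def)
  have "b\<^sup>2 \<le> a * c"
  proof (cases "a = 0 \<and> c = 0")
    case True
    thus ?thesis using quad[of 1 "- b"] by (simp add: power2_eq_square)
  next
    case False
    \<comment> \<open>The weights (c, -b) and (-b, a) turn the form into c (a c - b^2) and a (a c -
      b^2).\<close>
    have "0 \<le> c * (a * c - b\<^sup>2)" "0 \<le> a * (a * c - b\<^sup>2)"
      using quad[of c "- b"] quad[of "- b" a] by (simp_all add: power2_eq_square algebra_simps)
    thus ?thesis using False c0 a0 by (auto simp: zero_le_mult_iff)
  qed
  thus ?thesis by (simp add: a_def b_def c_def)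
qed

lemma inner_matrix_transpose:
  fixes A :: "real^'n^'m"
  shows "(A *v x) \<bullet> y = x \<bullet> (transpose A *v y)"
  by (metis dot_lmul_matrix inner_commute transpose_matrix_vector)

text \<open>Eigenvectors for distinct eigenvalues are orthogonal, hence independent, hence finite in
  number. Finiteness makes the \<open>Min\<close> in \<open>lambda_min\<close> meaningful.\<close>

lemma finite_eigenvalues_symmetric:
  fixes M :: "real^'n^'n"
  assumes sym: "transpose M = M"
  shows "finite {c. \<exists>v. v \<noteq> 0 \<and> M *v v = c *\<^sub>R v}"
proof -
  define S where "S = {c. \<exists>v. v \<noteq> 0 \<and> M *v v = c *\<^sub>R v}"
  have "\<forall>c\<in>S. \<exists>v. v \<noteq> 0 \<and> M *v v = c *\<^sub>R v" by (simp add: S_def)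
  then obtain e where e: "\<And>c. c \<in> S \<Longrightarrow> e c \<noteq> 0 \<and> M *v e c = c *\<^sub>R e c" by metis
  have inj: "inj_on e S"
  proof (rule inj_onI)
    fix c d assume "c \<in> S" "d \<in> S" "e c = e d"
    hence "c *\<^sub>R e c = d *\<^sub>R e c" "e c \<noteq> 0" using e by metis+
    thus "c = d" by simp
  qed
  have "pairwise orthogonal (e ` S)"
  proof (rule pairwiseI)
    fix u v assume "u \<in> e ` S" "v \<in> e ` S" "u \<noteq> v"
    then obtain c d where cd: "c \<in> S" "d \<in> S" "u = e c" "v = e d" "c \<noteq> d" by auto
    have "(M *v u) \<bullet> v = u \<bullet> (M *v v)" by (simp only: inner_matrix_transpose sym)
    hence "c * (u \<bullet> v) = d * (u \<bullet> v)" using e cd by simp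
    thus "orthogonal u v" using cd by (simp add: orthogonal_def)
  qed
  hence "finite (e ` S)"
    using pairwise_orthogonal_independent[of "e ` S"] e independent_imp_finite by fastforce
  thus ?thesis using inj finite_imageD unfolding S_def by blast
qed

text \<open>v minimizes the quadratic form on the unit sphere. The shift M - c I is semidefinite and
  its form vanishes at v, so Cauchy-Schwarz for the shift forces (M - c I) v = 0; no differentiation
  on the sphere is involved.\<close>

lemma symmetric_Rayleigh_min:
  fixes M :: "real^'n^'n"
  assumes sym: "transpose M = M"
  obtains v c where "v \<noteq> 0" "M *v v = c *\<^sub>R v" "\<And>x. c * (x \<bullet> x) \<le> x \<bullet> (M *v x)"
proof -
  have "continuous_on (sphere 0 1) (\<lambda>x::real^'n. x \<bullet> (M *v x))"
    by (intro continuous_intros linear_continuous_on matrix_vector_mul_bounded_linear)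
  moreover have "axis undefined 1 \<in> sphere (0::real^'n) 1" by simp
  ultimately obtain v where v: "v \<in> sphere 0 1" "\<And>x. x \<in> sphere 0 1 \<Longrightarrow> v \<bullet> (M *v v) \<le> x \<bullet> (M *v x)"
    using continuous_attains_inf[of "sphere (0::real^'n) 1" "\<lambda>x. x \<bullet> (M *v x)"] by auto
  define c where "c = v \<bullet> (M *v v)"
  have vv: "v \<bullet> v = 1" "v \<noteq> 0" using v(1) by (auto simp: norm_eq_1)
  have le: "c * (x \<bullet> x) \<le> x \<bullet> (M *v x)" for x
  proof (cases "x = 0")
    case False
    have "c \<le> (x /\<^sub>R norm x) \<bullet> (M *v (x /\<^sub>R norm x))"
      unfolding c_def using False by (intro v(2)) simp
    also have "\<dots> = (x \<bullet> (M *v x)) / (x \<bullet> x)"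
      using False by (simp add: matrix_vector_mult_scaleR dot_square_norm power2_eq_square field_simps)
    finally show ?thesis using False by (simp add: field_simps)
  qed simp
  let ?P = "\<lambda>x. M *v x - c *\<^sub>R x"
  have "linear ?P"
    by (intro linear_compose_sub matrix_vector_mul_linear linear_compose_scale_right linear_ident)
  moreover have "?P x \<bullet> y = x \<bullet> ?P y" for x y
    by (simp only: inner_diff_left inner_diff_right inner_matrix_transpose sym) simp
  moreover have "0 \<le> x \<bullet> ?P x" for x using le[of x] by (simp add: inner_diff_right)
  ultimately have "(?P v \<bullet> ?P v)\<^sup>2 \<le> (?P v \<bullet> ?P (?P v)) * (v \<bullet> ?P v)"
    by (rule psd_Cauchy_Schwarz)
  also have "v \<bullet> ?P v = 0" by (simp add: inner_diff_right vv c_def)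
  finally have "M *v v = c *\<^sub>R v" by simp
  thus thesis using that vv le by blast
qed

lemma lambda_min_symmetric:
  fixes M :: "real^'n^'n"
  assumes sym: "transpose M = M"
  shows lambda_min_eigenvector: "\<exists>v. v \<noteq> 0 \<and> M *v v = lambda_min M *\<^sub>R v"
    and lambda_min_le_Rayleigh: "lambda_min M * (x \<bullet> x) \<le> x \<bullet> (M *v x)"
proof -
  let ?S = "{c. \<exists>v. v \<noteq> 0 \<and> M *v v = c *\<^sub>R v}"
  obtain v c where vc: "v \<noteq> 0" "M *v v = c *\<^sub>R v" "\<And>x. c * (x \<bullet> x) \<le> x \<bullet> (M *v x)"
    using symmetric_Rayleigh_min[OF sym] by metis
  have c: "c \<in> ?S" using vc by blast
  note fin = finite_eigenvalues_symmetric[OF sym]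
  have "Min ?S \<in> ?S" using c by (intro Min_in fin) blast
  thus "\<exists>v. v \<noteq> 0 \<and> M *v v = lambda_min M *\<^sub>R v" unfolding lambda_min_def by blast
  have "lambda_min M \<le> c" unfolding lambda_min_def by (rule Min_le[OF fin c])
  hence "lambda_min M * (x \<bullet> x) \<le> c * (x \<bullet> x)" by (intro mult_right_mono) auto
  also note vc(3)
  finally show "lambda_min M * (x \<bullet> x) \<le> x \<bullet> (M *v x)" .
qed

text \<open>Through this bound a positive \<mu>A becomes coercivity: in x for A itself, and in y
  when applied to the transpose.\<close>

lemma lambda_min_gram_le:
  fixes A :: "real^'n^'m"
  shows "lambda_min (transpose A ** A) * (norm x)\<^sup>2 \<le> (norm (A *v x))\<^sup>2"
proof -
  have "transpose (transpose A ** A) = transpose A ** A"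
    by (simp add: matrix_transpose_mul)
  from lambda_min_le_Rayleigh[OF this, of x]
  have "lambda_min (transpose A ** A) * (x \<bullet> x) \<le> x \<bullet> (transpose A *v (A *v x))"
    by (simp only: matrix_vector_mul_assoc)
  also have "\<dots> = (A *v x) \<bullet> (A *v x)" by (simp only: inner_matrix_transpose)
  finally show ?thesis by (simp only: power2_norm_eq_inner)
qed

section \<open>Spectral norm estimates\<close>

lemma spectral_norm_nonneg: "0 \<le> spectral_norm A"
  unfolding spectral_norm_def by (intro onorm_pos_le matrix_vector_mul_bounded_linear)

lemma norm_matrix_vector_le: "norm (A *v x) \<le> spectral_norm A * norm x"
  unfolding spectral_norm_def by (intro onorm matrix_vector_mul_bounded_linear)

text \<open>With z the image of y, |z|^2 is the inner product of A z with y, so the bound for A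
  passes to its transpose after one factor |z| is cancelled.\<close>

lemma norm_transpose_vector_le: "norm (transpose A *v y) \<le> spectral_norm A * norm y"
proof -
  let ?z = "transpose A *v y"
  have "norm ?z * norm ?z = (A *v ?z) \<bullet> y"
    by (simp only: inner_matrix_transpose dot_square_norm power2_eq_square)
  also have "\<dots> \<le> norm (A *v ?z) * norm y" by (rule norm_cauchy_schwarz)
  also have "\<dots> \<le> (spectral_norm A * norm ?z) * norm y"
    by (intro mult_right_mono norm_matrix_vector_le norm_ge_zero)
  finally have "norm ?z * norm ?z \<le> norm ?z * (spectral_norm A * norm y)" by (simp only: mult_ac)
  thus ?thesis
    using spectral_norm_nonneg[of A] by (cases "?z = 0") (auto simp del: transpose_matrix_vector)
qed

lemma inner_matrix_le: "\<bar>y \<bullet> (A *v x)\<bar> \<le> spectral_norm A * (norm x * norm y)"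
proof -
  have "\<bar>y \<bullet> (A *v x)\<bar> \<le> norm y * norm (A *v x)" by (rule Cauchy_Schwarz_ineq2)
  also have "\<dots> \<le> norm y * (spectral_norm A * norm x)"
    by (intro mult_left_mono norm_matrix_vector_le norm_ge_zero)
  finally show ?thesis by (simp only: mult_ac)
qed

lemma spectral_norm_pos: "A \<noteq> 0 \<Longrightarrow> 0 < spectral_norm A"
  unfolding spectral_norm_def
  by (subst onorm_pos_lt[OF matrix_vector_mul_bounded_linear]) (metis matrix_eq matrix_vector_mult_0)

section \<open>Subgradients of smooth functions\<close>

text \<open>The descent lemma. Along the segment from x to x + d, \<phi> is F minus the nonconstant
  part of its quadratic majorant, and the Lipschitz bound on G makes its derivative
  nonpositive.\<close>

lemma smooth_descent:
  fixes F :: "'a::real_inner \<Rightarrow> real"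
  assumes G: "\<And>x. GDERIV F x :> G x" and lip: "L-lipschitz_on UNIV G"
  shows "F (x + d) \<le> F x + G x \<bullet> d + L / 2 * (norm d)\<^sup>2"
proof -
  define \<phi> where "\<phi> = (\<lambda>t. F (x + t *\<^sub>R d) - t * (G x \<bullet> d) - L / 2 * (norm d)\<^sup>2 * t\<^sup>2)"
  have "\<phi> 0 \<ge> \<phi> 1"
  proof (rule DERIV_nonpos_imp_nonincreasing[of 0 1 \<phi>])
    fix t :: real assume t: "0 \<le> t" "t \<le> 1"
    have "((\<lambda>t. x + t *\<^sub>R d) has_derivative (\<lambda>h. h *\<^sub>R d)) (at t)"
      by (auto intro!: derivative_eq_intros)
    moreover have "(F has_derivative (\<lambda>h. h \<bullet> G (x + t *\<^sub>R d))) (at (x + t *\<^sub>R d))"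
      using G by (simp add: gderiv_def)
    ultimately have "((\<lambda>t. F (x + t *\<^sub>R d)) has_derivative (\<lambda>h. (h *\<^sub>R d) \<bullet> G (x + t *\<^sub>R d))) (at t)"
      by (rule has_derivative_compose)
    moreover have "(\<lambda>h. (h *\<^sub>R d) \<bullet> G (x + t *\<^sub>R d)) = (*) (G (x + t *\<^sub>R d) \<bullet> d)"
      by (auto simp: inner_commute)
    ultimately have D: "((\<lambda>t. F (x + t *\<^sub>R d)) has_real_derivative (G (x + t *\<^sub>R d) \<bullet> d)) (at t)"
      unfolding has_field_derivative_def by simp
    have "(\<phi> has_real_derivative (G (x + t *\<^sub>R d) \<bullet> d - G x \<bullet> d - L * (norm d)\<^sup>2 * t)) (at t)"
      unfolding \<phi>_def by (rule derivative_eq_intros D refl | simp)+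
    moreover have "(G (x + t *\<^sub>R d) - G x) \<bullet> d \<le> L * (norm d)\<^sup>2 * t"
    proof -
      have "(G (x + t *\<^sub>R d) - G x) \<bullet> d \<le> norm (G (x + t *\<^sub>R d) - G x) * norm d"
        by (rule norm_cauchy_schwarz)
      also have "norm (G (x + t *\<^sub>R d) - G x) \<le> L * norm (t *\<^sub>R d)"
        using lipschitz_onD[OF lip, of "x + t *\<^sub>R d" x] by (simp add: dist_norm)
      finally show ?thesis using t by (simp add: mult_right_mono power2_eq_square mult_ac)
    qed
    ultimately show "\<exists>y. (\<phi> has_real_derivative y) (at t) \<and> y \<le> 0"
      by (auto simp: inner_diff_left)
  qed simp
  thus ?thesis by (simp add: \<phi>_def)
qed

text \<open>A subgradient of a differentiable function is its gradient, which gives the Lipschitz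
  bound. Cocoercivity is the Baillon-Haddad argument: the sharpened subgradient inequality
  \<open>key\<close>, used in both directions and added.\<close>

lemma subdiff_smooth:
  fixes f :: "'a::real_inner \<Rightarrow> ereal"
  assumes f: "smooth_fun L f" and p: "p \<in> subdiff f x" and q: "q \<in> subdiff f y"
  shows subdiff_smooth_lipschitz: "norm (p - q) \<le> L * norm (x - y)"
    and subdiff_smooth_cocoercive: "(norm (p - q))\<^sup>2 \<le> L * ((p - q) \<bullet> (x - y))"
proof -
  define F where "F = (\<lambda>z. real_of_ereal (f z))"
  have F: "f z = ereal (F z)" for z
    using f by (simp add: smooth_fun_def F_def ereal_real')
  obtain G where G: "\<And>x. GDERIV F x :> G x" and lip: "L-lipschitz_on UNIV G"
    using f unfolding smooth_fun_def F_def by blast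
  have sub: "F z + r \<bullet> (w - z) \<le> F w" if "r \<in> subdiff f z" for r z w
    using that by (auto simp: subdiff_def F)
  have grad: "r = G z" if r: "r \<in> subdiff f z" for r z
  proof -
    \<comment> \<open>F minus the linear functional of r is minimal at z, so its derivative there is
      zero; evaluating it at G z - r identifies r.\<close>
    have "((\<lambda>w. F w - r \<bullet> w) has_derivative (\<lambda>h. h \<bullet> G z - r \<bullet> h)) (at z)"
      using G[of z] unfolding gderiv_def by (auto intro!: derivative_eq_intros)
    moreover have "F z - r \<bullet> z \<le> F w - r \<bullet> w" for w
      using sub[OF r, of w] by (simp add: inner_diff_right)
    ultimately have "(\<lambda>h. h \<bullet> G z - r \<bullet> h) = (\<lambda>h. 0)"
      using differential_zero_maxmin[of z UNIV] by blast
    hence "(G z - r) \<bullet> G z - r \<bullet> (G z - r) = 0" by (rule fun_cong)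
    hence "(G z - r) \<bullet> (G z - r) = 0" by (simp add: inner_diff_right inner_commute)
    thus ?thesis by simp
  qed
  show lip': "norm (p - q) \<le> L * norm (x - y)"
    using lipschitz_onD[OF lip, of x y] grad[OF p] grad[OF q] by (simp add: dist_norm)
  have L0: "0 \<le> L" using lip by (rule lipschitz_on_nonneg)
  show "(norm (p - q))\<^sup>2 \<le> L * ((p - q) \<bullet> (x - y))"
  proof (cases "L = 0")
    case True
    thus ?thesis using lip' by simp
  next
    case False
    hence L: "L > 0" using L0 by simp
    \<comment> \<open>compare the affine minorant at \<open>z\<close> with the quadratic majorant at \<open>w\<close> after a gradient step from \<open>w\<close>\<close>
    have key: "F z + r \<bullet> (w - z) + (norm (s - r))\<^sup>2 / (2 * L) \<le> F w"
      if r: "r \<in> subdiff f z" and s: "s \<in> subdiff f w" for r s z w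
    proof -
      define d where "d = - (1 / L) *\<^sub>R (s - r)"
      have "F z + r \<bullet> (w + d - z) \<le> F w + s \<bullet> d + L / 2 * (norm d)\<^sup>2"
        using sub[OF r, of "w + d"] smooth_descent[OF G lip, of w d] grad[OF s] by simp
      moreover have "(s - r) \<bullet> d = - ((norm (s - r))\<^sup>2 / L)"
        by (simp add: d_def dot_square_norm)
      moreover have "L / 2 * (norm d)\<^sup>2 = (norm (s - r))\<^sup>2 / (2 * L)"
      proof -
        have "norm d = norm (s - r) / L" unfolding d_def norm_scaleR using L by simp
        thus ?thesis using L by (simp add: power_divide power2_eq_square[of L])
      qed
      moreover have "r \<bullet> (w + d - z) = r \<bullet> (w - z) + r \<bullet> d" by (simp add: inner_add_right inner_diff_right)
      ultimately have "F z + r \<bullet> (w - z) \<le> F w - (norm (s - r))\<^sup>2 / L + (norm (s - r))\<^sup>2 / (2 * L)"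
        by (simp add: inner_diff_left)
      thus ?thesis using L by (simp add: field_simps)
    qed
    have "(norm (p - q))\<^sup>2 / L \<le> (p - q) \<bullet> (x - y)"
      using key[OF p q] key[OF q p]
      by (simp add: inner_diff_left inner_diff_right norm_minus_commute field_simps)
    thus ?thesis using L by (simp add: field_simps)
  qed
qed

section \<open>Contraction in an operator norm\<close>

lemma norm_op_power2:
  "pos_def_op \<Phi> \<Longrightarrow> (norm_op \<Phi> u)\<^sup>2 = u \<bullet> \<Phi> u"
  unfolding norm_op_def pos_def_op_def
  by (cases "u = 0") (auto simp: less_imp_le)

lemma norm_op_nonneg: "pos_def_op \<Phi> \<Longrightarrow> 0 \<le> norm_op \<Phi> u"
  unfolding norm_op_def pos_def_op_def by (cases "u = 0") (auto simp: less_imp_le)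

lemma norm_op_Cauchy_Schwarz:
  assumes "pos_def_op \<Phi>"
  shows "u \<bullet> \<Phi> v \<le> norm_op \<Phi> u * norm_op \<Phi> v"
proof -
  have psd: "0 \<le> w \<bullet> \<Phi> w" for w
    using norm_op_power2[OF assms, of w] by (metis zero_le_power2)
  have "(u \<bullet> \<Phi> v)\<^sup>2 \<le> (u \<bullet> \<Phi> u) * (v \<bullet> \<Phi> v)"
    using assms by (intro psd_Cauchy_Schwarz psd) (auto simp: pos_def_op_def)
  also have "\<dots> = (norm_op \<Phi> u * norm_op \<Phi> v)\<^sup>2"
    by (simp add: norm_op_power2[OF assms] power_mult_distrib)
  finally show ?thesis
    by (rule power2_le_imp_le) (intro mult_nonneg_nonneg norm_op_nonneg assms)
qed

text \<open>Linearity of \<Phi> rewrites the assumed bound as (1 + c) |e|^2 <= e \<bullet> \<Phi> d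
  in the norm of \<Phi>; after Cauchy-Schwarz one factor |e| cancels.\<close>

lemma contractive_in_of_strong_monotonicity:
  assumes \<Phi>: "pos_def_op \<Phi>" and c: "0 < c"
    and mono: "\<And>w w'. c * (norm_op \<Phi> (T w - T w'))\<^sup>2
      \<le> (T w - T w') \<bullet> \<Phi> ((w - w') - (T w - T w'))"
  shows "contractive_in \<Phi> (inverse (1 + c)) T"
  unfolding contractive_in_def
proof (intro conjI allI \<Phi>)
  show "0 \<le> inverse (1 + c)" "inverse (1 + c) < 1" using c by (auto simp: field_simps)
  fix w w'
  define d e where "d = w - w'" and "e = T w - T w'"
  have "linear \<Phi>" using \<Phi> by (simp add: pos_def_op_def)
  hence "(1 + c) * (norm_op \<Phi> e)\<^sup>2 \<le> e \<bullet> \<Phi> d"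
    using mono[of w w']
    by (simp add: linear_diff inner_diff_right norm_op_power2[OF \<Phi>] algebra_simps flip: d_def e_def)
  also have "\<dots> \<le> norm_op \<Phi> e * norm_op \<Phi> d" by (rule norm_op_Cauchy_Schwarz[OF \<Phi>])
  finally have "norm_op \<Phi> e * ((1 + c) * norm_op \<Phi> e) \<le> norm_op \<Phi> e * norm_op \<Phi> d"
    by (simp add: power2_eq_square mult_ac)
  hence "(1 + c) * norm_op \<Phi> e \<le> norm_op \<Phi> d"
    using norm_op_nonneg[OF \<Phi>, of e] norm_op_nonneg[OF \<Phi>, of d]
    by (cases "norm_op \<Phi> e = 0") (auto simp: mult_le_cancel_left)
  thus "norm_op \<Phi> (T w - T w') \<le> inverse (1 + c) * norm_op \<Phi> (w - w')"
    using c by (simp add: field_simps flip: d_def e_def)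
qed

text \<open>In the norm of \<Phi>, monotonicity makes the cross term of |e + r|^2 nonnegative.
  Scaling |e|^2 + |r|^2 <= |d|^2 by K^2 and eliminating r through the error bound gives (K^2 + 1)
  |e|^2 <= K^2 |d|^2.\<close>

lemma contractive_in_of_error_bound:
  assumes \<Phi>: "pos_def_op \<Phi>" and K: "0 < K"
    and mono: "\<And>w w'. 0 \<le> (T w - T w') \<bullet> \<Phi> ((w - w') - (T w - T w'))"
    and err: "\<And>w w'. norm_op \<Phi> (T w - T w') \<le> K * norm_op \<Phi> ((w - w') - (T w - T w'))"
  shows "contractive_in \<Phi> (K / sqrt (K\<^sup>2 + 1)) T"
  unfolding contractive_in_def
proof (intro conjI allI \<Phi>)
  have sq: "K < sqrt (K\<^sup>2 + 1)" by (rule real_less_rsqrt) simp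
  show "0 \<le> K / sqrt (K\<^sup>2 + 1)" "K / sqrt (K\<^sup>2 + 1) < 1"
    using K sq add_nonneg_pos[of "K\<^sup>2" 1] by (auto simp: divide_less_eq not_less)
  fix w w'
  let ?e = "T w - T w'" and ?d = "w - w'"
  define r where "r = ?d - ?e"
  have lin: "linear \<Phi>" and sym: "\<Phi> r \<bullet> ?e = r \<bullet> \<Phi> ?e" using \<Phi> by (auto simp: pos_def_op_def)
  have m: "0 \<le> ?e \<bullet> \<Phi> r" using mono[of w w'] by (simp add: r_def)
  have "?d = ?e + r" by (simp add: r_def)
  hence "(norm_op \<Phi> ?d)\<^sup>2 = (norm_op \<Phi> ?e)\<^sup>2 + (norm_op \<Phi> r)\<^sup>2 + 2 * (?e \<bullet> \<Phi> r)"
    using sym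
    by (simp add: norm_op_power2[OF \<Phi>] linear_add[OF lin] inner_add_left inner_add_right inner_commute)
  hence "(norm_op \<Phi> ?e)\<^sup>2 + (norm_op \<Phi> r)\<^sup>2 \<le> (norm_op \<Phi> ?d)\<^sup>2" using m by simp
  hence "K\<^sup>2 * ((norm_op \<Phi> ?e)\<^sup>2 + (norm_op \<Phi> r)\<^sup>2) \<le> K\<^sup>2 * (norm_op \<Phi> ?d)\<^sup>2"
    by (intro mult_left_mono) auto
  moreover have "(norm_op \<Phi> ?e)\<^sup>2 \<le> (K * norm_op \<Phi> r)\<^sup>2"
    using err[of w w'] norm_op_nonneg[OF \<Phi>] by (intro power_mono) (auto simp: r_def)
  ultimately have "(norm_op \<Phi> ?e)\<^sup>2 * (K\<^sup>2 + 1) \<le> (K * norm_op \<Phi> ?d)\<^sup>2"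
    by (simp add: power_mult_distrib algebra_simps)
  hence "(norm_op \<Phi> ?e * sqrt (K\<^sup>2 + 1))\<^sup>2 \<le> (K * norm_op \<Phi> ?d)\<^sup>2"
    by (simp add: power_mult_distrib)
  hence "norm_op \<Phi> ?e * sqrt (K\<^sup>2 + 1) \<le> K * norm_op \<Phi> ?d"
    using K norm_op_nonneg[OF \<Phi>] by (intro power2_le_imp_le[OF _ mult_nonneg_nonneg]) auto
  moreover have "0 < sqrt (K\<^sup>2 + 1)" by (simp add: add_nonneg_pos)
  ultimately show "norm_op \<Phi> ?e \<le> K / sqrt (K\<^sup>2 + 1) * norm_op \<Phi> ?d"
    by (simp add: pos_le_divide_eq)
qed

section \<open>The iteration as a proximal point step\<close>

text \<open>Young's inequality with weights sqrt p and sqrt q. Zero coefficients are allowed because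
  the diagonal entries to which it is applied can vanish.\<close>

lemma quadratic_form_nonneg:
  fixes p q b X Y :: real
  assumes "0 \<le> p" "0 \<le> q" "b\<^sup>2 \<le> p * q" "0 \<le> X" "0 \<le> Y"
  shows "2 * b * (X * Y) \<le> p * X\<^sup>2 + q * Y\<^sup>2"
proof -
  have "\<bar>b\<bar> \<le> sqrt p * sqrt q"
    using assms by (metis real_sqrt_mult real_sqrt_le_mono real_sqrt_abs)
  hence "b * (X * Y) \<le> sqrt p * sqrt q * (X * Y)"
    using assms by (intro mult_right_mono) auto
  moreover have "2 * (sqrt p * X) * (sqrt q * Y) \<le> (sqrt p * X)\<^sup>2 + (sqrt q * Y)\<^sup>2"
    by (rule sum_squares_bound)
  ultimately show ?thesis using assms by (simp add: power_mult_distrib algebra_simps)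
qed

text \<open>After multiplication by p the form is a completed square plus the determinant times
  Y^2.\<close>

lemma quadratic_form_pos:
  fixes p q b X Y :: real
  assumes "0 < p" "b\<^sup>2 < p * q" "X \<noteq> 0 \<or> Y \<noteq> 0"
  shows "0 < p * X\<^sup>2 + q * Y\<^sup>2 + 2 * b * (X * Y)"
proof -
  have "p * (p * X\<^sup>2 + q * Y\<^sup>2 + 2 * b * (X * Y)) = (p * X + b * Y)\<^sup>2 + (p * q - b\<^sup>2) * Y\<^sup>2"
    by (simp add: power2_eq_square algebra_simps)
  also have "\<dots> > 0"
  proof (cases "Y = 0")
    case False
    thus ?thesis using assms by (intro add_nonneg_pos) auto
  qed (use assms in auto)
  finally show ?thesis using assms by (simp add: zero_less_mult_iff)
qed

lemma Phi_inner_self: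
  "w \<bullet> Phi A \<tau> \<sigma> w
    = (norm (fst w))\<^sup>2 / \<tau> + (norm (snd w))\<^sup>2 / \<sigma> - 2 * (snd w \<bullet> (A *v fst w))"
proof -
  have "fst w \<bullet> (transpose A *v snd w) = snd w \<bullet> (A *v fst w)"
    by (metis inner_matrix_transpose inner_commute)
  thus ?thesis
    by (simp add: Phi_def split_beta inner_prod_def inner_diff_right inner_add_right
        power2_norm_eq_inner del: transpose_matrix_vector)
qed

text \<open>The form dominates a 2 x 2 form in the block norms with diagonal 1/\<tau>, 1/\<sigma>
  and off-diagonal entry -|A|; the step-size condition is positivity of its determinant.\<close>

lemma pos_def_op_Phi:
  fixes A :: "real^'n^'m"
  assumes \<tau>: "0 < \<tau>" and \<sigma>: "0 < \<sigma>" and small: "\<tau> * \<sigma> * (spectral_norm A)\<^sup>2 < 1"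
  shows "pos_def_op (Phi A \<tau> \<sigma>)"
  unfolding pos_def_op_def
proof (intro conjI allI impI)
  show "linear (Phi A \<tau> \<sigma>)"
    by (rule linearI) (simp_all add: Phi_def split_beta matrix_vector_right_distrib scaleR_diff_right
        matrix_vector_mult_scaleR algebra_simps del: transpose_matrix_vector)
  show "Phi A \<tau> \<sigma> u \<bullet> v = u \<bullet> Phi A \<tau> \<sigma> v" for u v
  proof -
    have "(transpose A *v snd u) \<bullet> fst v = snd u \<bullet> (A *v fst v)"
      "(A *v fst u) \<bullet> snd v = fst u \<bullet> (transpose A *v snd v)"
      by (metis inner_matrix_transpose inner_commute)+
    thus ?thesis
      by (simp add: Phi_def split_beta inner_prod_def inner_diff_left inner_diff_right
          inner_add_left inner_add_right del: transpose_matrix_vector)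
  qed
  fix u :: "(real^'n) \<times> (real^'m)" assume "u \<noteq> 0"
  hence "norm (fst u) \<noteq> 0 \<or> norm (snd u) \<noteq> 0" by (metis norm_eq_zero prod_eqI fst_zero snd_zero)
  moreover have "(- spectral_norm A)\<^sup>2 < 1 / \<tau> * (1 / \<sigma>)"
    using \<tau> \<sigma> small by (simp add: field_simps)
  ultimately have "0 < 1 / \<tau> * (norm (fst u))\<^sup>2 + 1 / \<sigma> * (norm (snd u))\<^sup>2
      + 2 * (- spectral_norm A) * (norm (fst u) * norm (snd u))"
    using \<tau> by (intro quadratic_form_pos) auto
  moreover have "snd u \<bullet> (A *v fst u) \<le> spectral_norm A * (norm (fst u) * norm (snd u))"
    using inner_matrix_le[of "snd u" A "fst u"] by simp
  ultimately show "0 < u \<bullet> Phi A \<tau> \<sigma> u" unfolding Phi_inner_self by simp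
qed

lemma norm_prod_power2: "(norm w)\<^sup>2 = (norm (fst w))\<^sup>2 + (norm (snd w))\<^sup>2"
  by (simp add: norm_prod_def)

text \<open>\<zeta> bounds the largest eigenvalue of \<Phi>: the coupling term 2 |A| X Y is split
  evenly between the two squares.\<close>

lemma Phi_inner_le_zeta:
  "w \<bullet> Phi A \<tau> \<sigma> w \<le> zeta A \<tau> \<sigma> * (norm w)\<^sup>2"
proof -
  define X Y where "X = norm (fst w)" and "Y = norm (snd w)"
  define m where "m = max (1 / \<tau>) (1 / \<sigma>)"
  have "1 / \<tau> * X\<^sup>2 \<le> m * X\<^sup>2" "1 / \<sigma> * Y\<^sup>2 \<le> m * Y\<^sup>2"
    by (rule mult_right_mono; simp add: m_def)+
  moreover have "- (snd w \<bullet> (A *v fst w)) \<le> spectral_norm A * (X * Y)"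
    using inner_matrix_le[of "snd w" A "fst w"] by (simp add: X_def Y_def)
  moreover have "spectral_norm A * (2 * X * Y) \<le> spectral_norm A * (X\<^sup>2 + Y\<^sup>2)"
    by (intro mult_left_mono sum_squares_bound spectral_norm_nonneg)
  ultimately have "X\<^sup>2 / \<tau> + Y\<^sup>2 / \<sigma> - 2 * (snd w \<bullet> (A *v fst w))
      \<le> (m + spectral_norm A) * (X\<^sup>2 + Y\<^sup>2)"
    by (simp add: algebra_simps)
  thus ?thesis
    by (simp only: Phi_inner_self norm_prod_power2 zeta_def m_def X_def Y_def)
qed

text \<open>Stands in for a square root of \<Phi>: Cauchy-Schwarz in the \<Phi> inner product,
  applied to \<Phi> v and v, bounds |\<Phi> v|^2, and one factor |\<Phi> v| cancels.\<close>

lemma norm_Phi_le: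
  assumes "0 < \<tau>" "0 < \<sigma>" and \<Phi>: "pos_def_op (Phi A \<tau> \<sigma>)"
  shows "norm (Phi A \<tau> \<sigma> v) \<le> sqrt (zeta A \<tau> \<sigma>) * norm_op (Phi A \<tau> \<sigma>) v"
proof -
  let ?u = "Phi A \<tau> \<sigma> v" and ?N = "norm_op (Phi A \<tau> \<sigma>)"
  have z: "0 \<le> zeta A \<tau> \<sigma>"
    using assms spectral_norm_nonneg[of A] by (simp add: zeta_def le_max_iff_disj add_nonneg_nonneg)
  have "?N ?u \<le> sqrt (zeta A \<tau> \<sigma> * (norm ?u)\<^sup>2)"
    unfolding norm_op_def by (intro real_sqrt_le_mono Phi_inner_le_zeta)
  hence "?N ?u \<le> sqrt (zeta A \<tau> \<sigma>) * norm ?u" by (simp add: real_sqrt_mult)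
  hence "?N ?u * ?N v \<le> sqrt (zeta A \<tau> \<sigma>) * norm ?u * ?N v"
    by (intro mult_right_mono norm_op_nonneg[OF \<Phi>])
  moreover have "norm ?u * norm ?u \<le> ?N ?u * ?N v"
    using norm_op_Cauchy_Schwarz[OF \<Phi>, of ?u v] by (simp add: dot_square_norm power2_eq_square)
  ultimately have "norm ?u * norm ?u \<le> norm ?u * (sqrt (zeta A \<tau> \<sigma>) * ?N v)"
    by (simp add: mult_ac)
  thus ?thesis using norm_op_nonneg[OF \<Phi>, of v] z by (cases "?u = 0") auto
qed

text \<open>The extrapolation 2 x' - x is what makes the coupling blocks of \<Phi> symmetric: beyond
  A x' the second step leaves A (x' - x), which is the lower left block of \<Phi> applied to x -
  x'.\<close>

lemma cp_step_inclusion: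
  assumes f: "proper_convex_closed f" and g: "proper_convex_closed g" and "0 < \<tau>" "0 < \<sigma>"
  shows "Phi A \<tau> \<sigma> (w - cp_step f g A \<tau> \<sigma> w) \<in> saddle_op f g A (cp_step f g A \<tau> \<sigma> w)"
proof -
  obtain x y x' y' where w: "w = (x, y)" and w': "cp_step f g A \<tau> \<sigma> w = (x', y')"
    by (metis surj_pair)
  have x': "prox (\<lambda>z. ereal \<tau> * f z) (x - \<tau> *\<^sub>R (transpose A *v y)) = x'"
    and y': "prox (\<lambda>z. ereal \<sigma> * g z) (y + \<sigma> *\<^sub>R (A *v (2 *\<^sub>R x' - x))) = y'"
    using w' by (auto simp: w cp_step_def Let_def)
  let ?p = "(1 / \<tau>) *\<^sub>R (x - \<tau> *\<^sub>R (transpose A *v y) - x')"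
  let ?q = "(1 / \<sigma>) *\<^sub>R (y + \<sigma> *\<^sub>R (A *v (2 *\<^sub>R x' - x)) - y')"
  have "?p \<in> subdiff f x'" "?q \<in> subdiff g y'"
    using prox_eq_iff[OF f] prox_eq_iff[OF g] x' y' assms by metis+
  moreover have "A *v (2 *\<^sub>R x' - x) = A *v x' + A *v x' - A *v x"
    by (simp only: matrix_vector_mult_diff_distrib matrix_vector_right_distrib scaleR_2)
  hence "Phi A \<tau> \<sigma> (w - (x', y')) = (?p + transpose A *v y', ?q - A *v x')"
    using assms
    by (simp add: Phi_def w matrix_vector_mult_diff_distrib
        scaleR_diff_right scaleR_add_right del: transpose_matrix_vector)
  ultimately show ?thesis unfolding w' saddle_op_def by blast
qed

lemma cp_step_fixed_iff:
  assumes f: "proper_convex_closed f" and g: "proper_convex_closed g" and "0 < \<tau>" "0 < \<sigma>"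
  shows "cp_step f g A \<tau> \<sigma> w = w \<longleftrightarrow> saddle_solution f g A w"
proof -
  obtain x y where w: "w = (x, y)" by (metis surj_pair)
  have "cp_step f g A \<tau> \<sigma> w = w \<longleftrightarrow>
      prox (\<lambda>z. ereal \<tau> * f z) (x - \<tau> *\<^sub>R (transpose A *v y)) = x \<and>
      prox (\<lambda>z. ereal \<sigma> * g z) (y + \<sigma> *\<^sub>R (A *v x)) = y"
    by (auto simp: w cp_step_def Let_def scaleR_2 simp del: transpose_matrix_vector)
  also have "\<dots> \<longleftrightarrow> - (transpose A *v y) \<in> subdiff f x \<and> A *v x \<in> subdiff g y"
    unfolding prox_eq_iff[OF f \<open>0 < \<tau>\<close>] prox_eq_iff[OF g \<open>0 < \<sigma>\<close>]
    using assms by (simp add: algebra_simps del: transpose_matrix_vector)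
  also have "\<dots> \<longleftrightarrow> saddle_solution f g A w"
    using f g by (simp add: w saddle_solution_iff_subdiff proper_convex_closed_def)
  finally show ?thesis .
qed

lemma saddle_op_diff:
  assumes "u \<in> saddle_op f g A w" "u' \<in> saddle_op f g A w'"
  obtains p p' q q' where
    "p \<in> subdiff f (fst w)" "p' \<in> subdiff f (fst w')"
    "q \<in> subdiff g (snd w)" "q' \<in> subdiff g (snd w')"
    "u - u' = ((p - p') + transpose A *v snd (w - w'), (q - q') - A *v fst (w - w'))"
proof -
  obtain p q p' q' where
    "p \<in> subdiff f (fst w)" "p' \<in> subdiff f (fst w')"
    "q \<in> subdiff g (snd w)" "q' \<in> subdiff g (snd w')"
    "u = (p + transpose A *v snd w, q - A *v fst w)"
    "u' = (p' + transpose A *v snd w', q' - A *v fst w')"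
    using assms by (auto simp: saddle_op_def split_beta)
  moreover from this(5,6) have
    "u - u' = ((p - p') + transpose A *v snd (w - w'), (q - q') - A *v fst (w - w'))"
    by (simp add: matrix_vector_mult_diff_distrib del: transpose_matrix_vector)
  ultimately show thesis using that by blast
qed

text \<open>The coupling terms are skew and cancel.\<close>

lemma saddle_inner:
  fixes A :: "real^'n^'m"
  shows "(p + transpose A *v y, q - A *v x) \<bullet> (x, y) = p \<bullet> x + q \<bullet> y"
proof -
  have "(transpose A *v y) \<bullet> x = (A *v x) \<bullet> y"
    using inner_matrix_transpose[of A x y] by (simp only: inner_commute)
  thus ?thesis by (simp add: inner_add_left inner_diff_left del: transpose_matrix_vector)
qed

lemma saddle_op_strongly_monotone:
  assumes "proper_fun f" "proper_fun g" "strongly_convex \<mu>f f" "strongly_convex \<mu>g g"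
    and u: "u \<in> saddle_op f g A w" "u' \<in> saddle_op f g A w'"
  shows "\<mu>f * (norm (fst (w - w')))\<^sup>2 + \<mu>g * (norm (snd (w - w')))\<^sup>2 \<le> (w - w') \<bullet> (u - u')"
proof -
  obtain p p' q q' where pq: "p \<in> subdiff f (fst w)" "p' \<in> subdiff f (fst w')"
    "q \<in> subdiff g (snd w)" "q' \<in> subdiff g (snd w')"
    and d: "u - u' = ((p - p') + transpose A *v snd (w - w'), (q - q') - A *v fst (w - w'))"
    using saddle_op_diff[OF u] by metis
  have "(w - w') \<bullet> (u - u') = (p - p') \<bullet> fst (w - w') + (q - q') \<bullet> snd (w - w')"
    unfolding d by (metis saddle_inner inner_commute prod.collapse)
  thus ?thesis
    using subdiff_strongly_monotone[OF assms(1,3) pq(1,2)] subdiff_strongly_monotone[OF assms(2,4) pq(3,4)]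
    by simp
qed

lemma saddle_op_monotone:
  assumes "proper_fun f" "proper_fun g"
    and u: "u \<in> saddle_op f g A w" "u' \<in> saddle_op f g A w'"
  shows "0 \<le> (w - w') \<bullet> (u - u')"
proof -
  obtain p p' q q' where pq: "p \<in> subdiff f (fst w)" "p' \<in> subdiff f (fst w')"
    "q \<in> subdiff g (snd w)" "q' \<in> subdiff g (snd w')"
    and d: "u - u' = ((p - p') + transpose A *v snd (w - w'), (q - q') - A *v fst (w - w'))"
    using saddle_op_diff[OF u] by metis
  have "(w - w') \<bullet> (u - u') = (p - p') \<bullet> fst (w - w') + (q - q') \<bullet> snd (w - w')"
    unfolding d by (metis saddle_inner inner_commute prod.collapse)
  thus ?thesis
    using subdiff_monotone[OF assms(1) pq(1,2)] subdiff_monotone[OF assms(2) pq(3,4)] by simp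
qed

lemma cp_step_contractive_of_inverse_lipschitz:
  assumes f: "proper_convex_closed f" and g: "proper_convex_closed g" and \<tau>\<sigma>: "0 < \<tau>" "0 < \<sigma>"
    and small: "\<tau> * \<sigma> * (spectral_norm A)\<^sup>2 < 1"
    and R: "0 < R" and inv: "inverse_lipschitz (1 / R) (saddle_op f g A)"
  shows "contractive_in (Phi A \<tau> \<sigma>) (rate23 A R \<tau> \<sigma>) (cp_step f g A \<tau> \<sigma>)"
  unfolding rate23_def
proof (rule contractive_in_of_error_bound)
  show \<Phi>: "pos_def_op (Phi A \<tau> \<sigma>)" using \<tau>\<sigma> small by (rule pos_def_op_Phi)
  have z: "0 < zeta A \<tau> \<sigma>"
    using \<tau>\<sigma> spectral_norm_nonneg[of A] by (simp add: zeta_def less_max_iff_disj add_pos_nonneg)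
  thus "0 < R * zeta A \<tau> \<sigma>" using R by simp
  fix w w'
  let ?T = "cp_step f g A \<tau> \<sigma>" and ?\<Phi> = "Phi A \<tau> \<sigma>"
  let ?r = "(w - w') - (?T w - ?T w')" and ?e = "?T w - ?T w'"
  note inc = cp_step_inclusion[OF f g \<tau>\<sigma>, of A w] cp_step_inclusion[OF f g \<tau>\<sigma>, of A w']
  have "linear ?\<Phi>" using \<Phi> by (simp add: pos_def_op_def)
  hence r: "?\<Phi> (w - ?T w) - ?\<Phi> (w' - ?T w') = ?\<Phi> ?r"
    by (simp flip: linear_diff add: algebra_simps)
  show "0 \<le> ?e \<bullet> ?\<Phi> ?r"
    using saddle_op_monotone[OF _ _ inc] f g unfolding r by (simp add: proper_convex_closed_def)
  have "1 / R * norm ?e \<le> norm (?\<Phi> ?r)"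
    using inv inc unfolding inverse_lipschitz_def r[symmetric] by blast
  hence e: "norm ?e \<le> R * norm (?\<Phi> ?r)" using R by (simp add: field_simps)
  have "norm_op ?\<Phi> ?e \<le> sqrt (zeta A \<tau> \<sigma> * (norm ?e)\<^sup>2)"
    unfolding norm_op_def by (intro real_sqrt_le_mono Phi_inner_le_zeta)
  also have "\<dots> = sqrt (zeta A \<tau> \<sigma>) * norm ?e" by (simp add: real_sqrt_mult)
  \<comment> \<open>One factor sqrt \<zeta> came from passing to the Euclidean norm of e, the other
    comes from \<open>norm_Phi_le\<close>; together they give \<zeta>.\<close>
  also have "\<dots> \<le> sqrt (zeta A \<tau> \<sigma>) * (R * (sqrt (zeta A \<tau> \<sigma>) * norm_op ?\<Phi> ?r))"
    using e norm_Phi_le[OF \<tau>\<sigma> \<Phi>, of ?r] R z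
    by (intro mult_left_mono) (auto intro: order_trans mult_left_mono)
  also have "\<dots> = R * zeta A \<tau> \<sigma> * norm_op ?\<Phi> ?r" using z by simp
  finally show "norm_op ?\<Phi> ?e \<le> R * zeta A \<tau> \<sigma> * norm_op ?\<Phi> ?r" .
qed

section \<open>Optimal step sizes for the inverse Lipschitz rate\<close>

text \<open>The rate increases with \<zeta>, so the larger of 1/t and 1/s is to be minimized.
  Admissibility bounds their product below by ((1 + \<epsilon>) |A|)^2, so the larger one is at
  least (1 + \<epsilon>) |A|, which equal steps on the boundary attain.\<close>

lemma rate23_optimal:
  assumes R: "0 < R" and A: "A \<noteq> 0" and \<epsilon>: "0 < \<epsilon>"
  shows "is_arg_min (\<lambda>(t, s). rate23 A R t s) (admissible A \<epsilon>)
    (1 / ((1 + \<epsilon>) * spectral_norm A), 1 / ((1 + \<epsilon>) * spectral_norm A))"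
proof -
  define a where "a = spectral_norm A"
  have a: "a > 0" using spectral_norm_pos[OF A] by (simp add: a_def)
  let ?s = "1 / ((1 + \<epsilon>) * a)"
  have adm: "admissible A \<epsilon> (?s, ?s)"
    using a \<epsilon> by (simp add: admissible_def flip: a_def) (simp add: power2_eq_square)
  have mono: "K / sqrt (K\<^sup>2 + 1) \<le> K' / sqrt (K'\<^sup>2 + 1)" if K: "0 < K" "K \<le> K'" for K K' :: real
  proof -
    \<comment> \<open>In the rewritten quotient k occurs only once, which makes monotonicity
      visible.\<close>
    have eq: "k / sqrt (k\<^sup>2 + 1) = 1 / sqrt (1 + (1 / k)\<^sup>2)" if "0 < k" for k :: real
    proof -
      have "sqrt (k\<^sup>2 + 1) = sqrt (k\<^sup>2 * (1 + (1 / k)\<^sup>2))" using that by (simp add: field_simps)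
      also have "\<dots> = k * sqrt (1 + (1 / k)\<^sup>2)" using that by (simp add: real_sqrt_mult)
      finally show ?thesis using that by simp
    qed
    have "(1 / K')\<^sup>2 \<le> (1 / K)\<^sup>2" using K by (intro power_mono) (auto simp: field_simps)
    thus ?thesis using K eq[of K] eq[of K'] by (auto intro!: divide_left_mono simp: add_pos_nonneg)
  qed
  have "rate23 A R ?s ?s \<le> rate23 A R t s" if "admissible A \<epsilon> (t, s)" for t s
  proof -
    have ts: "0 < t" "0 < s" "t * s * a\<^sup>2 * (1 + \<epsilon>)\<^sup>2 \<le> 1"
      using that by (auto simp: admissible_def a_def)
    have "(1 + \<epsilon>) * a \<le> max (1 / t) (1 / s)"
    proof (rule ccontr)
      assume "\<not> ?thesis"
      hence "1 < t * ((1 + \<epsilon>) * a)" "1 < s * ((1 + \<epsilon>) * a)" using ts by (auto simp: field_simps not_le)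
      hence "1 * 1 < (t * ((1 + \<epsilon>) * a)) * (s * ((1 + \<epsilon>) * a))" by (intro mult_strict_mono) auto
      also have "\<dots> = t * s * a\<^sup>2 * (1 + \<epsilon>)\<^sup>2" by (simp add: power2_eq_square)
      finally show False using ts by simp
    qed
    hence "zeta A ?s ?s \<le> zeta A t s" by (simp add: zeta_def a_def)
    moreover have "0 < zeta A ?s ?s" using a \<epsilon> by (simp add: zeta_def add_pos_pos flip: a_def)
    ultimately show ?thesis unfolding rate23_def using R by (intro mono) auto
  qed
  thus ?thesis using adm unfolding is_arg_min_def a_def by (auto simp: not_less)
qed

section \<open>Inverse Lipschitz bounds\<close>

text \<open>Cauchy-Schwarz against z, then cancellation of |w - w'|. The constant keeps the shape 1
  / (B / l) to match the quotients \<open>R2\<close> and \<open>R3\<close> literally.\<close>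

lemma inverse_lipschitz_of_test_vector:
  fixes F :: "'a::real_inner \<Rightarrow> 'a set"
  assumes B: "0 < B" and l: "0 < l"
    and test: "\<And>u u' w w'. u \<in> F w \<Longrightarrow> u' \<in> F w' \<Longrightarrow>
      \<exists>z. norm z \<le> B * norm (w - w') \<and> l * (norm (w - w'))\<^sup>2 \<le> (u - u') \<bullet> z"
  shows "inverse_lipschitz (1 / (B / l)) F"
  unfolding inverse_lipschitz_def
proof (intro allI impI, elim conjE)
  fix w w' u u' assume u: "u \<in> F w" "u' \<in> F w'"
  obtain z where z: "norm z \<le> B * norm (w - w')" "l * (norm (w - w'))\<^sup>2 \<le> (u - u') \<bullet> z"
    using test[OF u] by blast
  note z(2)
  also have "(u - u') \<bullet> z \<le> norm (u - u') * norm z" by (rule norm_cauchy_schwarz)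
  also have "\<dots> \<le> norm (u - u') * (B * norm (w - w'))" by (intro mult_left_mono z) auto
  finally have "norm (w - w') * (l * norm (w - w')) \<le> norm (w - w') * (B * norm (u - u'))"
    by (simp add: power2_eq_square mult_ac)
  hence "l * norm (w - w') \<le> B * norm (u - u')"
    using B by (cases "norm (w - w') = 0") (auto simp: mult_le_cancel_left)
  thus "1 / (B / l) * norm (w - w') \<le> norm (u - u')" using B by (simp add: field_simps)
qed

lemma M_alpha_inner:
  "v \<bullet> (M_alpha A \<mu>f \<mu>g Lg \<mu>A \<alpha> *v v)
    = (\<mu>f + \<alpha> * \<mu>A) * (v $ 1)\<^sup>2 + \<mu>g * (v $ 2)\<^sup>2
      + 2 * (- (\<alpha> * Lg * spectral_norm A / 2)) * (v $ 1 * v $ 2)"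
  by (simp add: M_alpha_def inner_vec_def matrix_vector_mult_def sum_2 power2_eq_square algebra_simps)

lemma transpose_M_alpha: "transpose (M_alpha A \<mu>f \<mu>g Lg \<mu>A \<alpha>) = M_alpha A \<mu>f \<mu>g Lg \<mu>A \<alpha>"
  by (simp add: M_alpha_def transpose_def vec_eq_iff forall_2)

text \<open>The upper bound on \<alpha> is the larger root of det M = 0 as a quadratic in \<alpha>.
  Between 0 and this root the determinant is positive, hence so is the form at an eigenvector for
  the smallest eigenvalue.\<close>

lemma lambda_min_M_alpha_pos:
  assumes "0 \<le> \<mu>f" "0 < \<mu>g" "0 < Lg" "0 < \<mu>A" "A \<noteq> 0" and \<alpha>: "admissible_alpha A \<mu>f \<mu>g Lg \<mu>A \<alpha>"
  shows "0 < lambda_min (M_alpha A \<mu>f \<mu>g Lg \<mu>A \<alpha>)"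
proof -
  let ?M = "M_alpha A \<mu>f \<mu>g Lg \<mu>A \<alpha>"
  define k where "k = (Lg * spectral_norm A)\<^sup>2"
  have k: "k > 0" using assms spectral_norm_pos[OF \<open>A \<noteq> 0\<close>] by (simp add: k_def)
  define r where "r = sqrt ((\<mu>A * \<mu>g)\<^sup>2 + k * \<mu>g * \<mu>f)"
  have \<alpha>0: "0 < \<alpha>" and "\<alpha> < (2 * \<mu>A * \<mu>g + 2 * r) / k"
    using \<alpha> by (auto simp: admissible_alpha_def r_def k_def power_mult_distrib)
  hence up: "k * \<alpha> - 2 * (\<mu>A * \<mu>g) < 2 * r" using k by (simp add: field_simps)
  have r2: "r\<^sup>2 = (\<mu>A * \<mu>g)\<^sup>2 + k * \<mu>g * \<mu>f" and mr: "\<mu>A * \<mu>g \<le> r"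
    using assms k by (auto simp: r_def intro!: real_le_rsqrt)
  \<comment> \<open>Since r is at least \<mu>A \<mu>g and k \<alpha> is positive, the lower side
    holds as well, and the two-sided bound can be squared.\<close>
  have "- (2 * r) < k * \<alpha> - 2 * (\<mu>A * \<mu>g)"
    using mr k \<alpha>0 mult_pos_pos[of k \<alpha>] by linarith
  hence "\<bar>k * \<alpha> - 2 * (\<mu>A * \<mu>g)\<bar> < 2 * r" using up by simp
  from power_strict_mono[OF this, of 2]
  have "(k * \<alpha> - 2 * (\<mu>A * \<mu>g))\<^sup>2 < (2 * r)\<^sup>2" by simp
  hence "k * (k * \<alpha>\<^sup>2 - 4 * \<alpha> * (\<mu>A * \<mu>g)) < k * (4 * (\<mu>g * \<mu>f))"
    using r2 by (simp add: power2_eq_square algebra_simps)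
  hence "k * \<alpha>\<^sup>2 - 4 * \<alpha> * (\<mu>A * \<mu>g) < 4 * (\<mu>g * \<mu>f)" using k by simp
  hence det: "(- (\<alpha> * Lg * spectral_norm A / 2))\<^sup>2 < (\<mu>f + \<alpha> * \<mu>A) * \<mu>g"
    by (simp add: k_def power_mult_distrib power_divide algebra_simps)
  obtain v where v: "v \<noteq> 0" "?M *v v = lambda_min ?M *\<^sub>R v"
    using lambda_min_eigenvector[OF transpose_M_alpha] by metis
  have "0 < v \<bullet> (?M *v v)" unfolding M_alpha_inner
    using v(1) assms \<alpha>0 det by (intro quadratic_form_pos) (auto simp: vec_eq_iff forall_2 add_nonneg_pos)
  also have "v \<bullet> (?M *v v) = lambda_min ?M * (v \<bullet> v)" by (simp add: v(2))
  finally show ?thesis using v(1) zero_less_mult_pos2 inner_gt_zero_iff by blast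
qed

text \<open>The shift -\<alpha> A x in the second block of the test vector contributes \<alpha> |A
  x|^2, hence coercivity in x even if \<mu>f = 0, at the price of a term Q \<bullet> A x controlled
  by smoothness of g. What remains is the form of \<open>M_alpha\<close> at the pair of block
  norms.\<close>

lemma saddle_op_inverse_lipschitz_C2:
  fixes A :: "real^'n^'m"
  assumes pf: "proper_fun f" and pg: "proper_fun g" and \<mu>f: "0 \<le> \<mu>f" "strongly_convex \<mu>f f"
    and C2: "cond_C2 g A \<mu>g Lg \<mu>A" and \<alpha>: "0 < \<alpha>"
    and l: "0 < lambda_min (M_alpha A \<mu>f \<mu>g Lg \<mu>A \<alpha>)"
  shows "inverse_lipschitz (1 / R2 A \<mu>f \<mu>g Lg \<mu>A \<alpha>) (saddle_op f g A)"
  unfolding R2_def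
proof (rule inverse_lipschitz_of_test_vector[OF _ l])
  let ?l = "lambda_min (M_alpha A \<mu>f \<mu>g Lg \<mu>A \<alpha>)"
  define a where "a = spectral_norm A"
  have a: "0 \<le> a" by (simp add: a_def spectral_norm_nonneg)
  show "0 < 1 + \<alpha> * spectral_norm A" using a \<alpha> by (simp add: add_pos_nonneg flip: a_def)
  fix u u' w w' assume u: "u \<in> saddle_op f g A w" "u' \<in> saddle_op f g A w'"
  obtain p p' q q' where pq: "p \<in> subdiff f (fst w)" "p' \<in> subdiff f (fst w')"
    "q \<in> subdiff g (snd w)" "q' \<in> subdiff g (snd w')"
    and d: "u - u' = ((p - p') + transpose A *v snd (w - w'), (q - q') - A *v fst (w - w'))"
    using saddle_op_diff[OF u] by metis
  define x y P Q where "x = fst (w - w')" and "y = snd (w - w')" and "P = p - p'" and "Q = q - q'"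
  have xy: "w - w' = (x, y)" by (simp add: x_def y_def prod_eq_iff)
  have uu: "u - u' = (P + transpose A *v y, Q - A *v x)" using d by (simp only: x_def y_def P_def Q_def)
  let ?z = "(x, y) + \<alpha> *\<^sub>R (0, - (A *v x))"
  have g: "strongly_convex \<mu>g g" "smooth_fun Lg g" "\<mu>A * (norm x)\<^sup>2 \<le> (norm (A *v x))\<^sup>2" "0 < Lg"
    using C2 lambda_min_gram_le[of A x] by (auto simp: cond_C2_def)
  have P: "\<mu>f * (norm x)\<^sup>2 \<le> P \<bullet> x"
    using subdiff_strongly_monotone[OF pf \<mu>f(2) pq(1,2)] by (simp add: P_def x_def)
  have Q: "\<mu>g * (norm y)\<^sup>2 \<le> Q \<bullet> y"
    using subdiff_strongly_monotone[OF pg g(1) pq(3,4)] by (simp add: Q_def y_def)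
  have QL: "norm Q \<le> Lg * norm y"
    using subdiff_smooth_lipschitz[OF g(2) pq(3,4)] by (simp add: Q_def y_def)
  have QA: "Q \<bullet> (A *v x) \<le> Lg * a * (norm x * norm y)"
  proof -
    have "Q \<bullet> (A *v x) \<le> norm Q * norm (A *v x)" by (rule norm_cauchy_schwarz)
    also have "\<dots> \<le> (Lg * norm y) * (a * norm x)"
      using g(4) by (intro mult_mono QL) (auto simp: a_def norm_matrix_vector_le)
    finally show ?thesis by (simp add: mult_ac)
  qed
  have "(u - u') \<bullet> ?z = P \<bullet> x + Q \<bullet> y + \<alpha> * ((norm (A *v x))\<^sup>2 - Q \<bullet> (A *v x))"
    unfolding inner_add_right inner_scaleR_right uu saddle_inner
    by (simp add: inner_diff_left power2_norm_eq_inner)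
  moreover have "\<alpha> * (\<mu>A * (norm x)\<^sup>2 - Lg * a * (norm x * norm y))
      \<le> \<alpha> * ((norm (A *v x))\<^sup>2 - Q \<bullet> (A *v x))"
    using \<alpha> g(3) QA by (intro mult_left_mono) auto
  ultimately have lower: "(\<mu>f + \<alpha> * \<mu>A) * (norm x)\<^sup>2 + \<mu>g * (norm y)\<^sup>2
      + 2 * (- (\<alpha> * Lg * a / 2)) * (norm x * norm y) \<le> (u - u') \<bullet> ?z"
    using P Q by (simp add: algebra_simps)
  have "?l * (norm (w - w'))\<^sup>2 \<le> (u - u') \<bullet> ?z"
  proof -
    let ?v = "vector [norm x, norm y] :: real^2"
    have "?v \<bullet> ?v = (norm (w - w'))\<^sup>2"
      by (simp add: xy inner_vec_def sum_2 norm_prod_power2 power2_eq_square[of "norm x"] power2_eq_square[of "norm y"])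
    thus ?thesis using lambda_min_le_Rayleigh[OF transpose_M_alpha, of A \<mu>f \<mu>g Lg \<mu>A \<alpha> ?v] lower
      unfolding M_alpha_inner a_def by simp
  qed
  moreover have "norm ?z \<le> (1 + \<alpha> * spectral_norm A) * norm (w - w')"
  proof -
    have "norm (A *v x) \<le> a * norm x" by (simp add: a_def norm_matrix_vector_le)
    also have "\<dots> \<le> a * norm (w - w')"
      unfolding xy using a by (intro mult_left_mono norm_fst_le) auto
    finally have "\<alpha> * norm (A *v x) \<le> \<alpha> * (a * norm (w - w'))" using \<alpha> by simp
    moreover have "norm ?z \<le> norm (x, y) + norm (\<alpha> *\<^sub>R (0::real^'n, - (A *v x)))" by (rule norm_triangle_ineq)
    moreover have "norm (\<alpha> *\<^sub>R (0::real^'n, - (A *v x))) = \<alpha> * norm (A *v x)"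
      using \<alpha> by (simp add: norm_Pair)
    ultimately have "norm ?z \<le> norm (w - w') + \<alpha> * (a * norm (w - w'))"
      unfolding xy by linarith
    thus ?thesis by (simp add: a_def distrib_right)
  qed
  ultimately show "\<exists>z. norm z \<le> (1 + \<alpha> * spectral_norm A) * norm (w - w') \<and>
      ?l * (norm (w - w'))\<^sup>2 \<le> (u - u') \<bullet> z" by blast
qed

text \<open>The skew shift of the test vector contributes \<epsilon> (|s|^2 + |t|^2), where s is the
  transpose of A applied to y and t = A x; this is coercive in both blocks. The cross terms P
  \<bullet> s and Q \<bullet> t are absorbed partly by cocoercivity and partly by this gain.\<close>

lemma saddle_op_inverse_lipschitz_C3:
  fixes A :: "real^'n^'m"
  assumes pf: "proper_fun f" and pg: "proper_fun g"
    and C3: "cond_C3 f g A Lf Lg \<mu>A" and \<delta>: "admissible_delta_eps A Lf Lg \<mu>A \<delta> \<epsilon>"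
  shows R3_pos: "0 < R3 A \<mu>A \<delta> \<epsilon>"
    and "inverse_lipschitz (1 / R3 A \<mu>A \<delta> \<epsilon>) (saddle_op f g A)"
proof -
  define a where "a = spectral_norm A"
  define L where "L = max Lf Lg"
  define l where "l = \<epsilon> * (\<mu>A - a / (2 * \<delta>))"
  have a: "0 \<le> a" by (simp add: a_def spectral_norm_nonneg)
  have sm: "smooth_fun Lf f" "smooth_fun Lg g" "0 \<le> L" "0 < \<mu>A"
    "\<mu>A = lambda_min (transpose A ** A)" "\<mu>A = lambda_min (A ** transpose A)"
    using C3 by (auto simp: cond_C3_def L_def)
  have \<epsilon>: "0 < \<epsilon>" and d: "a / (2 * \<mu>A) < \<delta>"
    and e: "ereal \<epsilon> < ereal 2 / ereal (L * a * \<delta>)"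
    using \<delta> by (auto simp: admissible_delta_eps_def a_def L_def)
  have "0 \<le> a / (2 * \<mu>A)" using a sm by simp
  hence \<delta>0: "0 < \<delta>" using d by linarith
  \<comment> \<open>If the product vanishes, the bound on \<epsilon> is infinite, but the inequality
    then reads 0 <= 2.\<close>
  have small: "\<epsilon> * (L * a * \<delta>) \<le> 2"
  proof (cases "L * a * \<delta> = 0")
    case False
    hence "0 < L * a * \<delta>" using a sm(3) \<delta>0 by (simp add: order_less_le)
    moreover from this have "\<epsilon> < 2 / (L * a * \<delta>)" using e False by simp
    ultimately show ?thesis by (simp add: pos_less_divide_eq)
  next
    case True
    thus ?thesis by (simp only: mult_zero_right)
  qed
  \<comment> \<open>The lower bound on \<delta> is exactly what makes
    \<open>\<mu>A - a / (2 * \<delta>)\<close> positive.\<close>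
  have l: "0 < l" unfolding l_def
    using d \<delta>0 sm(4) \<epsilon> by (intro mult_pos_pos) (simp_all add: field_simps)
  have B: "0 < 1 + \<epsilon> * a" using \<epsilon> a by (simp add: add_pos_nonneg)
  have R3: "R3 A \<mu>A \<delta> \<epsilon> = (1 + \<epsilon> * a) / l" by (simp add: R3_def l_def a_def)
  show "0 < R3 A \<mu>A \<delta> \<epsilon>" unfolding R3 using B l by simp
  show "inverse_lipschitz (1 / R3 A \<mu>A \<delta> \<epsilon>) (saddle_op f g A)" unfolding R3
  proof (rule inverse_lipschitz_of_test_vector[OF B l])
    fix u u' w w' assume u: "u \<in> saddle_op f g A w" "u' \<in> saddle_op f g A w'"
    obtain p p' q q' where pq: "p \<in> subdiff f (fst w)" "p' \<in> subdiff f (fst w')"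
      "q \<in> subdiff g (snd w)" "q' \<in> subdiff g (snd w')"
      and diff: "u - u' = ((p - p') + transpose A *v snd (w - w'), (q - q') - A *v fst (w - w'))"
      using saddle_op_diff[OF u] by metis
    define x y P Q where "x = fst (w - w')" and "y = snd (w - w')" and "P = p - p'" and "Q = q - q'"
    have xy: "w - w' = (x, y)" by (simp add: x_def y_def prod_eq_iff)
    have uu: "u - u' = (P + transpose A *v y, Q - A *v x)"
      using diff by (simp only: x_def y_def P_def Q_def)
    define s t where "s = transpose A *v y" and "t = A *v x"
    let ?z = "(x, y) + \<epsilon> *\<^sub>R (s, - t)"
    have st: "norm s \<le> a * norm y" "norm t \<le> a * norm x"
      unfolding s_def t_def a_def by (rule norm_transpose_vector_le norm_matrix_vector_le)+
    have gram: "\<mu>A * (norm x)\<^sup>2 \<le> (norm t)\<^sup>2" "\<mu>A * (norm y)\<^sup>2 \<le> (norm s)\<^sup>2"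
      using lambda_min_gram_le[of A x] lambda_min_gram_le[of "transpose A" y] sm(5,6)
      by (simp_all add: s_def t_def del: transpose_matrix_vector)
    \<comment> \<open>Young's inequality with weight \<open>\<delta>\<close>, its quadratic term absorbed by cocoercivity\<close>
    have young: "- (\<epsilon> * (a / (2 * \<delta>))) * (norm v)\<^sup>2 \<le> D \<bullet> c + \<epsilon> * (D \<bullet> r)"
      if "norm r \<le> a * norm v" "(norm D)\<^sup>2 \<le> L * (D \<bullet> c)" "0 \<le> D \<bullet> c" for D c r :: "real^'k" and v :: "real^'j"
    proof -
      have "- (D \<bullet> r) \<le> norm D * norm r" using Cauchy_Schwarz_ineq2[of D r] by linarith
      also have "\<dots> \<le> norm D * (a * norm v)" using that by (intro mult_left_mono) auto
      finally have 1: "- (D \<bullet> r) \<le> a * (norm D * norm v)" by (simp add: mult_ac)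
      have "2 * (norm D * \<delta>) * norm v \<le> (norm D * \<delta>)\<^sup>2 + (norm v)\<^sup>2" by (rule sum_squares_bound)
      hence "norm D * norm v \<le> \<delta> / 2 * (norm D)\<^sup>2 + 1 / (2 * \<delta>) * (norm v)\<^sup>2"
        using \<delta>0 by (simp add: field_simps power2_eq_square)
      hence "\<epsilon> * a * (norm D * norm v) \<le> \<epsilon> * a * (\<delta> / 2 * (norm D)\<^sup>2 + 1 / (2 * \<delta>) * (norm v)\<^sup>2)"
        using \<epsilon> a by (intro mult_left_mono) auto
      moreover have "\<epsilon> * a * \<delta> / 2 * (norm D)\<^sup>2 \<le> \<epsilon> * a * \<delta> / 2 * (L * (D \<bullet> c))"
        using \<epsilon> a \<delta>0 that by (intro mult_left_mono) auto
      moreover have "\<epsilon> * (L * a * \<delta>) / 2 * (D \<bullet> c) \<le> 1 * (D \<bullet> c)"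
        using small that by (intro mult_right_mono) auto
      moreover have "\<epsilon> * - (D \<bullet> r) \<le> \<epsilon> * (a * (norm D * norm v))"
        using 1 \<epsilon> by (intro mult_left_mono) auto
      ultimately show ?thesis by (simp add: algebra_simps)
    qed
    have Px: "0 \<le> P \<bullet> x" "(norm P)\<^sup>2 \<le> L * (P \<bullet> x)"
    proof -
      show P0: "0 \<le> P \<bullet> x" using subdiff_monotone[OF pf pq(1,2)] by (simp add: P_def x_def)
      have "(norm P)\<^sup>2 \<le> Lf * (P \<bullet> x)"
        using subdiff_smooth_cocoercive[OF sm(1) pq(1,2)] by (simp add: P_def x_def)
      also have "\<dots> \<le> L * (P \<bullet> x)" using P0 by (intro mult_right_mono) (auto simp: L_def)
      finally show "(norm P)\<^sup>2 \<le> L * (P \<bullet> x)" .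
    qed
    have Qy: "0 \<le> Q \<bullet> y" "(norm Q)\<^sup>2 \<le> L * (Q \<bullet> y)"
    proof -
      show Q0: "0 \<le> Q \<bullet> y" using subdiff_monotone[OF pg pq(3,4)] by (simp add: Q_def y_def)
      have "(norm Q)\<^sup>2 \<le> Lg * (Q \<bullet> y)"
        using subdiff_smooth_cocoercive[OF sm(2) pq(3,4)] by (simp add: Q_def y_def)
      also have "\<dots> \<le> L * (Q \<bullet> y)" using Q0 by (intro mult_right_mono) (auto simp: L_def)
      finally show "(norm Q)\<^sup>2 \<le> L * (Q \<bullet> y)" .
    qed
    have "(u - u') \<bullet> ?z = P \<bullet> x + Q \<bullet> y + \<epsilon> * ((P + s) \<bullet> s - (Q - t) \<bullet> t)"
      unfolding inner_add_right inner_scaleR_right uu saddle_inner by (simp add: s_def t_def)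
    also have "\<dots> = (P \<bullet> x + \<epsilon> * (P \<bullet> s)) + (Q \<bullet> y + \<epsilon> * (Q \<bullet> (- t)))
        + \<epsilon> * ((norm s)\<^sup>2 + (norm t)\<^sup>2)"
      by (simp add: inner_add_left inner_diff_left power2_norm_eq_inner algebra_simps)
    finally have test: "(u - u') \<bullet> ?z = \<dots>" .
    \<comment> \<open>The roles cross: s is bounded through y and t through x, so the loss for P is
      charged to |y|^2 and the loss for Q to |x|^2.\<close>
    have "- (\<epsilon> * (a / (2 * \<delta>))) * (norm y)\<^sup>2 \<le> P \<bullet> x + \<epsilon> * (P \<bullet> s)"
      by (rule young[OF st(1) Px(2,1)])
    moreover have "- (\<epsilon> * (a / (2 * \<delta>))) * (norm x)\<^sup>2 \<le> Q \<bullet> y + \<epsilon> * (Q \<bullet> (- t))"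
      using st(2) Qy by (intro young) auto
    moreover have "\<epsilon> * (\<mu>A * (norm y)\<^sup>2 + \<mu>A * (norm x)\<^sup>2) \<le> \<epsilon> * ((norm s)\<^sup>2 + (norm t)\<^sup>2)"
      using gram \<epsilon> by (intro mult_left_mono add_mono) auto
    ultimately have "l * ((norm x)\<^sup>2 + (norm y)\<^sup>2) \<le> (u - u') \<bullet> ?z"
      unfolding test l_def by (simp add: algebra_simps)
    moreover have "norm ?z \<le> (1 + \<epsilon> * a) * norm (w - w')"
    proof -
      have "(norm s)\<^sup>2 + (norm t)\<^sup>2 \<le> (a * norm y)\<^sup>2 + (a * norm x)\<^sup>2"
        using st by (intro add_mono power_mono) auto
      also have "\<dots> = (a * norm (x, y))\<^sup>2" by (simp add: power_mult_distrib norm_prod_power2 algebra_simps)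
      finally have "norm (s, - t) \<le> a * norm (x, y)"
        using a by (intro power2_le_imp_le[OF _ mult_nonneg_nonneg]) (auto simp: norm_prod_power2)
      hence "\<epsilon> * norm (s, - t) \<le> \<epsilon> * (a * norm (x, y))" using \<epsilon> by simp
      moreover have "norm ?z \<le> norm (x, y) + norm (\<epsilon> *\<^sub>R (s, - t))" by (rule norm_triangle_ineq)
      ultimately have "norm ?z \<le> norm (x, y) + \<epsilon> * (a * norm (x, y))"
        unfolding norm_scaleR abs_of_pos[OF \<epsilon>] by linarith
      thus ?thesis by (simp add: xy distrib_right)
    qed
    ultimately show "\<exists>z. norm z \<le> (1 + \<epsilon> * a) * norm (w - w') \<and> l * (norm (w - w'))\<^sup>2 \<le> (u - u') \<bullet> z"
      by (intro exI[of _ ?z]) (simp add: xy norm_prod_power2[of "(x, y)"])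
  qed
qed

section \<open>The strongly convex case\<close>

text \<open>k is the smaller root of (1 - S) c^2 - (a + b) c + a b, which equals (a - c) (b - c) - S
  c^2. The leading coefficient is positive, so the quadratic is nonnegative up to k; k is positive
  because the discriminant D lies below (a + b)^2.\<close>

lemma smaller_root:
  fixes a b S :: real
  assumes ab: "0 < a" "0 < b" and S: "0 \<le> S" "S < 1"
  defines "k \<equiv> (a + b - sqrt ((a - b)\<^sup>2 + 4 * S * a * b)) / (2 * (1 - S))"
  shows smaller_root_pos: "0 < k"
    and smaller_root_quadratic: "\<And>c. c \<le> k \<Longrightarrow> c\<^sup>2 * S \<le> (a - c) * (b - c)"
proof -
  define D where "D = (a - b)\<^sup>2 + 4 * S * a * b"
  have D0: "0 \<le> D" using ab S by (simp add: D_def)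
  have eq: "(a + b)\<^sup>2 - D = 4 * (a * b) * (1 - S)" by (simp add: D_def power2_eq_square algebra_simps)
  have "D < (a + b)\<^sup>2" using eq ab S by (smt (verit) mult_pos_pos)
  hence "sqrt D < a + b" using ab by (intro real_less_lsqrt) auto
  thus "0 < k" using S by (simp add: k_def D_def)
  fix c assume "c \<le> k"
  hence "sqrt D \<le> (a + b) - 2 * (1 - S) * c" using S by (simp add: k_def D_def field_simps)
  hence "(sqrt D)\<^sup>2 \<le> ((a + b) - 2 * (1 - S) * c)\<^sup>2" using D0 by (intro power_mono) auto
  hence "0 \<le> ((a + b) - 2 * (1 - S) * c)\<^sup>2 - D" using D0 by simp
  also have "\<dots> = 4 * (1 - S) * ((a - c) * (b - c) - c\<^sup>2 * S)"
    by (simp add: D_def power2_eq_square algebra_simps)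
  finally show "c\<^sup>2 * S \<le> (a - c) * (b - c)" using S by (simp add: zero_le_mult_iff)
qed

text \<open>Exposes \<open>kappa\<close> as the smaller root above, with a = \<mu>f \<tau>, b =
  \<mu>g \<sigma> and S the squared coupling strength.\<close>

lemma kappa_eq:
  fixes A :: "real^'n^'m" and \<tau> \<sigma> :: real
  defines "S \<equiv> \<sigma> * \<tau> * (spectral_norm A)\<^sup>2"
  shows "kappa A \<mu>f \<mu>g \<tau> \<sigma> = (\<mu>f * \<tau> + \<mu>g * \<sigma>
    - sqrt ((\<mu>f * \<tau> - \<mu>g * \<sigma>)\<^sup>2 + 4 * S * (\<mu>f * \<tau>) * (\<mu>g * \<sigma>))) / (2 * (1 - S))"
proof -
  have "4 * (spectral_norm A)\<^sup>2 * \<mu>f * \<mu>g * \<tau>\<^sup>2 * \<sigma>\<^sup>2 = 4 * S * (\<mu>f * \<tau>) * (\<mu>g * \<sigma>)"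
    by (simp add: S_def power2_eq_square)
  thus ?thesis by (simp only: kappa_def S_def)
qed

lemma cp_step_contractive_C1:
  fixes A :: "real^'n^'m"
  assumes f: "proper_convex_closed f" and g: "proper_convex_closed g" and \<tau>\<sigma>: "0 < \<tau>" "0 < \<sigma>"
    and small: "\<tau> * \<sigma> * (spectral_norm A)\<^sup>2 < 1" and C1: "cond_C1 f g \<mu>f \<mu>g"
  shows kappa_pos: "0 < kappa A \<mu>f \<mu>g \<tau> \<sigma>"
    and "contractive_in (Phi A \<tau> \<sigma>) (rate1 A \<mu>f \<mu>g \<tau> \<sigma>) (cp_step f g A \<tau> \<sigma>)"
proof -
  define n where "n = spectral_norm A"
  have n: "0 \<le> n" by (simp add: n_def spectral_norm_nonneg)
  have \<mu>: "0 < \<mu>f" "0 < \<mu>g" "strongly_convex \<mu>f f" "strongly_convex \<mu>g g"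
    using C1 by (auto simp: cond_C1_def)
  have pf: "proper_fun f" "proper_fun g" using f g by (auto simp: proper_convex_closed_def)
  have S: "0 \<le> \<sigma> * \<tau> * n\<^sup>2" "\<sigma> * \<tau> * n\<^sup>2 < 1" using \<tau>\<sigma> small by (auto simp: n_def mult_ac)
  note root = smaller_root[of "\<mu>f * \<tau>" "\<mu>g * \<sigma>", OF _ _ S, folded kappa_eq[where A = A and \<tau> = \<tau> and \<sigma> = \<sigma>, folded n_def]]
  have \<mu>\<tau>: "0 < \<mu>f * \<tau>" "0 < \<mu>g * \<sigma>" using \<mu> \<tau>\<sigma> by auto
  show k: "0 < kappa A \<mu>f \<mu>g \<tau> \<sigma>" by (rule root(1)[OF \<mu>\<tau>])
  \<comment> \<open>The first two entries of the minimum keep the diagonal of diag (\<mu>f, \<mu>g)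
    - c \<Phi> nonnegative; the third ensures the determinant condition.\<close>
  define c where "c = min (min (\<mu>f * \<tau>) (\<mu>g * \<sigma>)) (kappa A \<mu>f \<mu>g \<tau> \<sigma>)"
  have c: "0 < c" "c \<le> \<mu>f * \<tau>" "c \<le> \<mu>g * \<sigma>" using k \<mu>\<tau> by (auto simp: c_def)
  have quad: "c\<^sup>2 * (\<sigma> * \<tau> * n\<^sup>2) \<le> (\<mu>f * \<tau> - c) * (\<mu>g * \<sigma> - c)"
    by (rule root(2)[OF \<mu>\<tau>]) (simp add: c_def)
  \<comment> \<open>The quadratic inequality divided by \<sigma> \<tau>, now in the coefficients of
    the two squared block norms.\<close>
  have det: "(c * n)\<^sup>2 \<le> (\<mu>f - c / \<tau>) * (\<mu>g - c / \<sigma>)"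
  proof -
    have "(\<sigma> * \<tau>) * ((\<mu>f - c / \<tau>) * (\<mu>g - c / \<sigma>)) = (\<mu>f * \<tau> - c) * (\<mu>g * \<sigma> - c)"
      using \<tau>\<sigma> by (simp add: field_simps)
    hence "(\<sigma> * \<tau>) * (c * n)\<^sup>2 \<le> (\<sigma> * \<tau>) * ((\<mu>f - c / \<tau>) * (\<mu>g - c / \<sigma>))"
      using quad by (simp only: power_mult_distrib mult_ac)
    thus ?thesis using \<tau>\<sigma> by simp
  qed
  have \<Phi>: "pos_def_op (Phi A \<tau> \<sigma>)" using \<tau>\<sigma> small by (rule pos_def_op_Phi)
  have dom: "c * (e \<bullet> Phi A \<tau> \<sigma> e) \<le> \<mu>f * (norm (fst e))\<^sup>2 + \<mu>g * (norm (snd e))\<^sup>2" for e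
  proof -
    define X Y where "X = norm (fst e)" and "Y = norm (snd e)"
    have "2 * (c * n) * (X * Y) \<le> (\<mu>f - c / \<tau>) * X\<^sup>2 + (\<mu>g - c / \<sigma>) * Y\<^sup>2"
      using c \<tau>\<sigma> det by (intro quadratic_form_nonneg) (auto simp: X_def Y_def field_simps)
    moreover have "- (snd e \<bullet> (A *v fst e)) \<le> n * (X * Y)"
      using inner_matrix_le[of "snd e" A "fst e"] by (simp add: X_def Y_def n_def)
    hence "c * - (snd e \<bullet> (A *v fst e)) \<le> c * (n * (X * Y))" using c by (intro mult_left_mono) auto
    ultimately show ?thesis unfolding Phi_inner_self X_def[symmetric] Y_def[symmetric]
      by (simp add: algebra_simps)
  qed
  show "contractive_in (Phi A \<tau> \<sigma>) (rate1 A \<mu>f \<mu>g \<tau> \<sigma>) (cp_step f g A \<tau> \<sigma>)"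
    unfolding rate1_def c_def[symmetric]
  proof (rule contractive_in_of_strong_monotonicity[OF \<Phi> c(1)])
    fix w w'
    let ?T = "cp_step f g A \<tau> \<sigma>" and ?\<Phi> = "Phi A \<tau> \<sigma>"
    let ?e = "?T w - ?T w'"
    note inc = cp_step_inclusion[OF f g \<tau>\<sigma>, of A w] cp_step_inclusion[OF f g \<tau>\<sigma>, of A w']
    have "linear ?\<Phi>" using \<Phi> by (simp add: pos_def_op_def)
    hence r: "?\<Phi> (w - ?T w) - ?\<Phi> (w' - ?T w') = ?\<Phi> ((w - w') - ?e)"
      by (simp flip: linear_diff add: algebra_simps)
    have "c * (norm_op ?\<Phi> ?e)\<^sup>2 \<le> \<mu>f * (norm (fst ?e))\<^sup>2 + \<mu>g * (norm (snd ?e))\<^sup>2"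
      unfolding norm_op_power2[OF \<Phi>] by (rule dom)
    also have "\<dots> \<le> ?e \<bullet> ?\<Phi> ((w - w') - ?e)"
      using saddle_op_strongly_monotone[OF pf \<mu>(3,4) inc] unfolding r .
    finally show "c * (norm_op ?\<Phi> ?e)\<^sup>2 \<le> ?e \<bullet> ?\<Phi> ((w - w') - ?e)" .
  qed
qed

section \<open>Optimal step sizes for the strongly convex rate\<close>

text \<open>Put q = sqrt (\<mu>f t \<mu>g s) and d = |A| sqrt (t s). The root condition and the
  inequality of arithmetic and geometric means give c <= q / (1 + d) = (m / n) d / (1 + d), which
  increases with d, and admissibility means d <= r. The stated steps balance \<mu>f t = \<mu>g s and
  have d = r, so they attain the bound.\<close>

lemma rate1_optimal:
  fixes A :: "real^'n^'m"
  assumes \<mu>: "0 < \<mu>f" "0 < \<mu>g" and A: "A \<noteq> 0" and \<epsilon>: "0 < \<epsilon>"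
  shows "is_arg_min (\<lambda>(t, s). rate1 A \<mu>f \<mu>g t s) (admissible A \<epsilon>)
    (1 / ((1 + \<epsilon>) * spectral_norm A) * sqrt (\<mu>g / \<mu>f),
     1 / ((1 + \<epsilon>) * spectral_norm A) * sqrt (\<mu>f / \<mu>g))"
proof -
  define n r m where "n = spectral_norm A" and "r = 1 / (1 + \<epsilon>)" and "m = sqrt (\<mu>f * \<mu>g)"
  have n: "0 < n" using spectral_norm_pos[OF A] by (simp add: n_def)
  have r: "0 < r" "r < 1" using \<epsilon> by (auto simp: r_def)
  have m: "0 < m" "m\<^sup>2 = \<mu>f * \<mu>g" using \<mu> by (auto simp: m_def)
  define t0 s0 where "t0 = 1 / ((1 + \<epsilon>) * n) * sqrt (\<mu>g / \<mu>f)"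
    and "s0 = 1 / ((1 + \<epsilon>) * n) * sqrt (\<mu>f / \<mu>g)"
  define C where "C = (\<lambda>t s. min (min (\<mu>f * t) (\<mu>g * s)) (kappa A \<mu>f \<mu>g t s))"
  have ts0: "0 < t0" "0 < s0" using \<mu> n \<epsilon> by (auto simp: t0_def s0_def)
  have sq: "a * sqrt (b / a) = sqrt (a * b)" if "0 < a" "0 < b" for a b :: real
  proof -
    have "a * sqrt (b / a) = sqrt (a\<^sup>2 * (b / a))" using that by (simp only: real_sqrt_mult) simp
    also have "a\<^sup>2 * (b / a) = a * b" using that by (simp add: power2_eq_square)
    finally show ?thesis .
  qed
  have "\<mu>f * t0 = r / n * (\<mu>f * sqrt (\<mu>g / \<mu>f))" "\<mu>g * s0 = r / n * (\<mu>g * sqrt (\<mu>f / \<mu>g))"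
    by (simp_all add: t0_def s0_def r_def)
  hence f0: "\<mu>f * t0 = r * m / n" and g0: "\<mu>g * s0 = r * m / n"
    unfolding sq[OF \<mu>] sq[OF \<mu>(2,1)] by (simp_all add: m_def mult.commute)
  have st0: "s0 * t0 * n\<^sup>2 = r\<^sup>2"
  proof -
    have "(\<mu>f * \<mu>g) * (s0 * t0 * n\<^sup>2) = (\<mu>f * t0) * (\<mu>g * s0) * n\<^sup>2" by (simp add: mult_ac)
    also have "\<dots> = (\<mu>f * \<mu>g) * r\<^sup>2"
      unfolding f0 g0 m(2)[symmetric] using n by (simp add: power2_eq_square)
    finally show ?thesis using \<mu> by simp
  qed
  have opt: "r * m / (n * (1 + r)) \<le> C t0 s0"
  proof -
    define q where "q = r * m / n"
    have q: "0 < q" using r m n by (simp add: q_def)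
    \<comment> \<open>Both products equal q here, so the square root collapses to 2 r q.\<close>
    have "kappa A \<mu>f \<mu>g t0 s0 = (2 * q - sqrt (4 * r\<^sup>2 * q * q)) / (2 * (1 - r\<^sup>2))"
      unfolding kappa_eq n_def[symmetric] st0 f0 g0 q_def[symmetric] by simp
    also have "sqrt (4 * r\<^sup>2 * q * q) = 2 * r * q"
      using r q by (intro real_sqrt_unique) (auto simp: power2_eq_square)
    also have "(2 * q - 2 * r * q) / (2 * (1 - r\<^sup>2)) = q / (1 + r)"
    proof -
      have "2 * (1 - r\<^sup>2) = (2 - 2 * r) * (1 + r)" by (simp add: power2_eq_square algebra_simps)
      moreover have "2 * q - 2 * r * q = (2 - 2 * r) * q" by (simp add: algebra_simps)
      ultimately show ?thesis using r by simp
    qed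
    finally have "kappa A \<mu>f \<mu>g t0 s0 = q / (1 + r)" .
    moreover have "q / (1 + r) \<le> q" using q r by (simp add: field_simps)
    moreover have "r * m / (n * (1 + r)) = q / (1 + r)" by (simp add: q_def)
    ultimately show ?thesis unfolding C_def f0 g0 q_def[symmetric] by simp
  qed
  have bound: "0 < C t s \<and> C t s \<le> r * m / (n * (1 + r))" if "admissible A \<epsilon> (t, s)" for t s
  proof -
    have ts: "0 < t" "0 < s" "t * s * n\<^sup>2 * (1 + \<epsilon>)\<^sup>2 \<le> 1"
      using that by (auto simp: admissible_def n_def)
    define d where "d = n * sqrt (t * s)"
    have d0: "0 < d" using n ts by (simp add: d_def)
    have d2: "d\<^sup>2 = s * t * n\<^sup>2" using ts by (simp add: d_def power_mult_distrib)
    have "(d * (1 + \<epsilon>))\<^sup>2 \<le> 1\<^sup>2" using ts(3) by (simp add: power_mult_distrib d2 mult_ac)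
    hence "d * (1 + \<epsilon>) \<le> 1" by (rule power2_le_imp_le) simp
    hence dr: "d \<le> r" using \<epsilon> by (simp add: r_def field_simps)
    have "d\<^sup>2 < 1\<^sup>2" using d0 dr r by (intro power_strict_mono) auto
    hence S: "0 \<le> s * t * n\<^sup>2" "s * t * n\<^sup>2 < 1" using d2 ts by auto
    note root = smaller_root[of "\<mu>f * t" "\<mu>g * s", OF _ _ S, folded kappa_eq[where A = A and \<tau> = t and \<sigma> = s, folded n_def]]
    have pos: "0 < \<mu>f * t" "0 < \<mu>g * s" using \<mu> ts by auto
    define c where "c = C t s"
    have c: "0 < c" "c \<le> \<mu>f * t" "c \<le> \<mu>g * s" "c \<le> kappa A \<mu>f \<mu>g t s"
      using root(1)[OF pos] pos by (auto simp: c_def C_def)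
    define q where "q = m * sqrt (t * s)"
    have q0: "0 \<le> q" using m ts by (simp add: q_def)
    have q2: "q\<^sup>2 = (\<mu>f * t) * (\<mu>g * s)" using ts by (simp add: q_def power_mult_distrib m(2))
    \<comment> \<open>c is below both products, hence below their geometric mean. This makes q - c
      nonnegative, as needed to take roots in (c d)^2 <= (q - c)^2.\<close>
    have cq: "c \<le> q"
    proof (rule power2_le_imp_le[OF _ q0])
      have "c * c \<le> (\<mu>f * t) * (\<mu>g * s)" using c by (intro mult_mono) auto
      thus "c\<^sup>2 \<le> q\<^sup>2" by (simp only: q2 power2_eq_square[of c])
    qed
    have "(2 * q)\<^sup>2 \<le> (\<mu>f * t + \<mu>g * s)\<^sup>2"
      using sum_squares_bound[of "\<mu>f * t" "\<mu>g * s"] by (simp add: power_mult_distrib q2 power2_sum mult_ac)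
    hence "2 * q \<le> \<mu>f * t + \<mu>g * s" using pos by (intro power2_le_imp_le[OF _ add_nonneg_nonneg]) auto
    hence "c * (2 * q) \<le> c * (\<mu>f * t + \<mu>g * s)" using c by (intro mult_left_mono) auto
    hence "(\<mu>f * t - c) * (\<mu>g * s - c) \<le> (q - c)\<^sup>2"
      by (simp add: power2_diff q2) (simp add: power2_eq_square algebra_simps)
    with root(2)[OF pos c(4)] have "(c * d)\<^sup>2 \<le> (q - c)\<^sup>2" by (simp add: power_mult_distrib d2)
    hence "c * d \<le> q - c" by (rule power2_le_imp_le) (use cq in simp)
    hence "c \<le> q / (1 + d)" using d0 by (simp add: field_simps)
    \<comment> \<open>The ratio of q to d is the constant m / n, so the bound depends on the steps
      only through d.\<close>
    also have "\<dots> = m / n * (d / (1 + d))" using n by (simp add: q_def d_def)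
    also have "\<dots> \<le> m / n * (r / (1 + r))"
      using m n d0 dr r by (intro mult_left_mono) (auto simp: field_simps)
    finally show ?thesis using c(1) by (simp add: c_def mult_ac)
  qed
  have adm: "admissible A \<epsilon> (t0, s0)"
  proof -
    have "t0 * s0 * n\<^sup>2 * (1 + \<epsilon>)\<^sup>2 = r\<^sup>2 * (1 + \<epsilon>)\<^sup>2" using st0 by (simp add: mult_ac)
    also have "\<dots> = 1" using \<epsilon> by (simp add: r_def power_divide)
    finally show ?thesis using ts0 by (simp add: admissible_def n_def)
  qed
  have "rate1 A \<mu>f \<mu>g t0 s0 \<le> rate1 A \<mu>f \<mu>g t s" if "admissible A \<epsilon> (t, s)" for t s
  proof -
    have "C t s \<le> C t0 s0" "0 < C t s" using bound[OF that] opt by auto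
    moreover have "rate1 A \<mu>f \<mu>g t s = inverse (1 + C t s)" for t s by (simp add: rate1_def C_def)
    ultimately show ?thesis by (simp only:) (intro le_imp_inverse_le; simp)
  qed
  hence "is_arg_min (\<lambda>(t, s). rate1 A \<mu>f \<mu>g t s) (admissible A \<epsilon>) (t0, s0)"
    using adm by (auto simp: is_arg_min_def not_less)
  thus ?thesis by (simp only: t0_def s0_def n_def)
qed

text \<open>Provides |A| > 0 in the last two cases, where the optimal steps divide by it.\<close>

lemma lambda_min_gram_pos_imp_nonzero:
  fixes A :: "real^'n^'m"
  assumes "0 < lambda_min (transpose A ** A)"
  shows "A \<noteq> 0"
proof
  assume "A = 0"
  moreover have "norm (axis undefined 1 :: real^'n) = 1" by simp
  ultimately show False using lambda_min_gram_le[of A "axis undefined 1"] assms by simp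
qed

theorem theorem2:
  fixes f :: "real^'n \<Rightarrow> ereal" and g :: "real^'m \<Rightarrow> ereal" and A :: "real^'n^'m"
    and \<tau> \<sigma> :: real
  assumes "proper_convex_closed f" and "proper_convex_closed g"
    and "0 < \<tau>" and "0 < \<sigma>"
  shows "{w. cp_step f g A \<tau> \<sigma> w = w} = {w. saddle_solution f g A w} \<and>
   (\<forall>\<epsilon>>0. \<tau> * \<sigma> * (spectral_norm A)\<^sup>2 * (1 + \<epsilon>)\<^sup>2 \<le> 1 \<longrightarrow>
     (\<forall>\<mu>f \<mu>g. cond_C1 f g \<mu>f \<mu>g \<longrightarrow>
        contractive_in (Phi A \<tau> \<sigma>) (rate1 A \<mu>f \<mu>g \<tau> \<sigma>) (cp_step f g A \<tau> \<sigma>) \<and>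
        rate1 A \<mu>f \<mu>g \<tau> \<sigma> < 1 \<and>
        kappa A \<mu>f \<mu>g \<tau> \<sigma> > 0 \<and>
        (A \<noteq> 0 \<longrightarrow>
          is_arg_min (\<lambda>(t, s). rate1 A \<mu>f \<mu>g t s) (admissible A \<epsilon>)
            (1 / ((1 + \<epsilon>) * spectral_norm A) * sqrt (\<mu>g / \<mu>f),
             1 / ((1 + \<epsilon>) * spectral_norm A) * sqrt (\<mu>f / \<mu>g)))) \<and>
     (\<forall>\<mu>f \<mu>g Lg \<mu>A \<alpha>.
        0 \<le> \<mu>f \<and> strongly_convex \<mu>f f \<and> cond_C2 g A \<mu>g Lg \<mu>A \<and>
        admissible_alpha A \<mu>f \<mu>g Lg \<mu>A \<alpha> \<longrightarrow>
        (let R = R2 A \<mu>f \<mu>g Lg \<mu>A \<alpha> in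
          R > 0 \<and> inverse_lipschitz (1 / R) (saddle_op f g A) \<and>
          contractive_in (Phi A \<tau> \<sigma>) (rate23 A R \<tau> \<sigma>) (cp_step f g A \<tau> \<sigma>) \<and>
          rate23 A R \<tau> \<sigma> < 1 \<and>
          is_arg_min (\<lambda>(t, s). rate23 A R t s) (admissible A \<epsilon>)
            (1 / ((1 + \<epsilon>) * spectral_norm A), 1 / ((1 + \<epsilon>) * spectral_norm A)))) \<and>
     (\<forall>Lf Lg \<mu>A \<delta> \<epsilon>'.
        cond_C3 f g A Lf Lg \<mu>A \<and> admissible_delta_eps A Lf Lg \<mu>A \<delta> \<epsilon>' \<longrightarrow>
        (let R = R3 A \<mu>A \<delta> \<epsilon>' in
          R > 0 \<and> inverse_lipschitz (1 / R) (saddle_op f g A) \<and>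
          contractive_in (Phi A \<tau> \<sigma>) (rate23 A R \<tau> \<sigma>) (cp_step f g A \<tau> \<sigma>) \<and>
          rate23 A R \<tau> \<sigma> < 1 \<and>
          is_arg_min (\<lambda>(t, s). rate23 A R t s) (admissible A \<epsilon>)
            (1 / ((1 + \<epsilon>) * spectral_norm A), 1 / ((1 + \<epsilon>) * spectral_norm A)))))"
proof (intro conjI allI impI)
  note f = assms(1) and g = assms(2) and \<tau>\<sigma> = assms(3,4)
  have pf: "proper_fun f" "proper_fun g" using f g by (auto simp: proper_convex_closed_def)
  show "{w. cp_step f g A \<tau> \<sigma> w = w} = {w. saddle_solution f g A w}"
    using cp_step_fixed_iff[OF f g \<tau>\<sigma>] by simp
  fix \<epsilon> :: real assume \<epsilon>: "0 < \<epsilon>" and step: "\<tau> * \<sigma> * (spectral_norm A)\<^sup>2 * (1 + \<epsilon>)\<^sup>2 \<le> 1"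
  \<comment> \<open>The margin (1 + \<epsilon>)^2 > 1 turns the step-size bound into the strict
    inequality behind positive definiteness of \<Phi>.\<close>
  have small: "\<tau> * \<sigma> * (spectral_norm A)\<^sup>2 < 1"
  proof (rule ccontr)
    assume "\<not> ?thesis"
    hence "1 * 1 < \<tau> * \<sigma> * (spectral_norm A)\<^sup>2 * (1 + \<epsilon>)\<^sup>2"
      using \<epsilon> by (intro mult_le_less_imp_less) (auto simp: power2_eq_square algebra_simps add_pos_pos)
    thus False using step by simp
  qed
  {
    fix \<mu>f \<mu>g assume C1: "cond_C1 f g \<mu>f \<mu>g"
    note C = cp_step_contractive_C1[OF f g \<tau>\<sigma> small C1]
    show "contractive_in (Phi A \<tau> \<sigma>) (rate1 A \<mu>f \<mu>g \<tau> \<sigma>) (cp_step f g A \<tau> \<sigma>)"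
      "0 < kappa A \<mu>f \<mu>g \<tau> \<sigma>"
      by (fact C)+
    thus "rate1 A \<mu>f \<mu>g \<tau> \<sigma> < 1" by (simp add: contractive_in_def)
    show "is_arg_min (\<lambda>(t, s). rate1 A \<mu>f \<mu>g t s) (admissible A \<epsilon>)
        (1 / ((1 + \<epsilon>) * spectral_norm A) * sqrt (\<mu>g / \<mu>f),
         1 / ((1 + \<epsilon>) * spectral_norm A) * sqrt (\<mu>f / \<mu>g))" if "A \<noteq> 0"
      using C1 that \<epsilon> by (intro rate1_optimal) (auto simp: cond_C1_def)
  next
    fix \<mu>f \<mu>g Lg \<mu>A \<alpha>
    assume *: "0 \<le> \<mu>f \<and> strongly_convex \<mu>f f \<and> cond_C2 g A \<mu>g Lg \<mu>A \<and>
        admissible_alpha A \<mu>f \<mu>g Lg \<mu>A \<alpha>"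
    define R where "R = R2 A \<mu>f \<mu>g Lg \<mu>A \<alpha>"
    have A: "A \<noteq> 0" and \<alpha>: "0 < \<alpha>"
      using * lambda_min_gram_pos_imp_nonzero by (auto simp: cond_C2_def admissible_alpha_def)
    have l: "0 < lambda_min (M_alpha A \<mu>f \<mu>g Lg \<mu>A \<alpha>)"
      using * A by (intro lambda_min_M_alpha_pos) (auto simp: cond_C2_def)
    hence R: "0 < R"
      using \<alpha> spectral_norm_nonneg[of A] by (simp add: R_def R2_def add_pos_nonneg)
    have inv: "inverse_lipschitz (1 / R) (saddle_op f g A)"
      unfolding R_def using * \<alpha> l by (intro saddle_op_inverse_lipschitz_C2 pf) auto
    note C = cp_step_contractive_of_inverse_lipschitz[OF f g \<tau>\<sigma> small R inv]
    show "let R = R2 A \<mu>f \<mu>g Lg \<mu>A \<alpha> in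
          R > 0 \<and> inverse_lipschitz (1 / R) (saddle_op f g A) \<and>
          contractive_in (Phi A \<tau> \<sigma>) (rate23 A R \<tau> \<sigma>) (cp_step f g A \<tau> \<sigma>) \<and>
          rate23 A R \<tau> \<sigma> < 1 \<and>
          is_arg_min (\<lambda>(t, s). rate23 A R t s) (admissible A \<epsilon>)
            (1 / ((1 + \<epsilon>) * spectral_norm A), 1 / ((1 + \<epsilon>) * spectral_norm A))"
      unfolding R_def[symmetric] Let_def
      using R inv C rate23_optimal[OF R A \<epsilon>] by (simp add: contractive_in_def)
  next
    fix Lf Lg \<mu>A \<delta> \<epsilon>'
    assume *: "cond_C3 f g A Lf Lg \<mu>A \<and> admissible_delta_eps A Lf Lg \<mu>A \<delta> \<epsilon>'"
    define R where "R = R3 A \<mu>A \<delta> \<epsilon>'"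
    have A: "A \<noteq> 0" using * lambda_min_gram_pos_imp_nonzero by (auto simp: cond_C3_def)
    have R: "0 < R" and inv: "inverse_lipschitz (1 / R) (saddle_op f g A)"
      unfolding R_def using * saddle_op_inverse_lipschitz_C3[OF pf] by blast+
    note C = cp_step_contractive_of_inverse_lipschitz[OF f g \<tau>\<sigma> small R inv]
    show "let R = R3 A \<mu>A \<delta> \<epsilon>' in
          R > 0 \<and> inverse_lipschitz (1 / R) (saddle_op f g A) \<and>
          contractive_in (Phi A \<tau> \<sigma>) (rate23 A R \<tau> \<sigma>) (cp_step f g A \<tau> \<sigma>) \<and>
          rate23 A R \<tau> \<sigma> < 1 \<and>
          is_arg_min (\<lambda>(t, s). rate23 A R t s) (admissible A \<epsilon>)
            (1 / ((1 + \<epsilon>) * spectral_norm A), 1 / ((1 + \<epsilon>) * spectral_norm A))"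
      unfolding R_def[symmetric] Let_def
      using R inv C rate23_optimal[OF R A \<epsilon>] by (simp add: contractive_in_def)
  }
qed

end
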